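(* Let $d\geq 2$, let $\beta\colon \mathrm{Pol}(O_d^+)\to\mathcal{B}$ be a surjective unital ${}^*$-homomorphism onto a unital ${}^*$-algebra $\mathcal{B}=\mathrm{Pol}(\mathbb{X})$ which admits a faithful ${}^*$-representation on a Hilbert space, and write $\dot u_{ij}=\beta(u_{ij})$. Let $(\mathcal{A},\varphi)$ be a non-commutative probability space and let $X_1,\dots,X_d\in\mathcal{A}$ be self-adjoint, freely independent and identically distributed. Put $Y_j=\sum_{i=1}^d X_i\otimes\dot u_{ij}\in\mathcal{A}\otimes\mathcal{B}$ for $j=1,\dots,d$. Suppose that $Y_1,\dots,Y_d$ are free with amalgamation over $\mathcal{B}$ in the $\mathcal{B}$-valued probability space $(\mathcal{A}\otimes\mathcal{B},\mathcal{B},E)$, $E=\varphi\otimes\mathrm{id}$. Then either $\mathbb{X}\subset H_d^+$ (i.e. $\dot u_{ij}^2=\dot u_{ij}^4$ for all $i,j$, equivalently $\beta$ factors through $\mathrm{Pol}(H_d^+)$), or $X_1,\dots,X_d$ are semicircular, i.e. $\kappa_n(X_i)=0$ for all $n\geq 3$ and all $i$.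
   Context: $\mathrm{Pol}(O_d^+)$ is the universal unital ${}^*$-algebra generated by $d^2$ self-adjoint elements $u_{ij}$ ($1\le i,j\le d$) such that the matrix $u=(u_{ij})$ satisfies $u^\top u=uu^\top=\mathbb{1}$, i.e. $\sum_i u_{ij}^2=\mathbb 1=\sum_j u_{ij}^2$ and $\sum_i u_{ij}u_{ij'}=0=\sum_j u_{ij}u_{i'j}$ for $i\ne i'$, $j\neq j'$. $\mathrm{Pol}(H_d^+)$ is the quotient of $\mathrm{Pol}(O_d^+)$ by the ideal generated by $u_{ij}u_{ij'}$ and $u_{ji}u_{j'i}$ for all $i$ and $j\ne j'$ (in a C*-setting equivalent to adding $u_{ij}^3=u_{ij}$). A non-commutative probability space $(\mathcal{A},\varphi)$ is a unital ${}^*$-algebra with a unital positive linear functional. For a ${}^*$-subalgebra $\mathcal B\subset\mathcal C$ and a conditional expectation $E\colon\mathcal C\to\mathcal B$ ($E(b)=b$, $E(b_1ab_2)=b_1E(a)b_2$), subalgebras $\mathcal C_k\supset\mathcal B$ are free with amalgamation over $\mathcal B$ if $E(a_1\cdots a_n)=0$ whenever $a_r\in\mathcal C_{k_r}$, $k_1\ne k_2\ne\dots\ne k_n$, $E(a_r)=0$; elements are free with amalgamation if the algebras they generate together with $\mathcal B$ are. Here $\mathcal B$ is identified with $\mathbb 1\otimes\mathcal B$. $\kappa_n$ denotes the scalar free cumulants of $(\mathcal A,\varphi)$, defined by $\varphi(a_1\cdots a_m)=\sum_{\pi\in NC(m)}\prod_{B\in\pi}\kappa_{|B|}(a_i:i\in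 B)$, and $\kappa_n(X)=\kappa_n(X,\dots,X)$. *)

theory Defs
  imports Complex_Main "HOL-Library.Disjoint_Sets"
begin

class star_algebra = ring_1 +
  fixes cscale :: "complex \<Rightarrow> 'a \<Rightarrow> 'a"
    and sadj :: "'a \<Rightarrow> 'a"
  assumes cscale_add_right: "cscale c (x + y) = cscale c x + cscale c y"
    and cscale_add_left: "cscale (c + e) x = cscale c x + cscale e x"
    and cscale_cscale: "cscale c (cscale e x) = cscale (c * e) x"
    and cscale_one: "cscale 1 x = x"
    and cscale_mult_left: "cscale c x * y = cscale c (x * y)"
    and cscale_mult_right: "x * cscale c y = cscale c (x * y)"
    and sadj_sadj: "sadj (sadj x) = x"
    and sadj_add: "sadj (x + y) = sadj x + sadj y"
    and sadj_mult: "sadj (x * y) = sadj y * sadj x"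
    and sadj_cscale: "sadj (cscale c x) = cscale (cnj c) (sadj x)"

inductive_set salg :: "'a::star_algebra set \<Rightarrow> 'a set" for S where
  salg_one: "1 \<in> salg S"
| salg_gen: "x \<in> S \<Longrightarrow> x \<in> salg S"
| salg_add: "x \<in> salg S \<Longrightarrow> y \<in> salg S \<Longrightarrow> x + y \<in> salg S"
| salg_mult: "x \<in> salg S \<Longrightarrow> y \<in> salg S \<Longrightarrow> x * y \<in> salg S"
| salg_scale: "x \<in> salg S \<Longrightarrow> cscale c x \<in> salg S"
| salg_adj: "x \<in> salg S \<Longrightarrow> sadj x \<in> salg S"

class chilbert = ab_group_add +
  fixes hscale :: "complex \<Rightarrow> 'a \<Rightarrow> 'a"
    and hinner :: "'a \<Rightarrow> 'a \<Rightarrow> complex"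
  assumes hscale_add_right: "hscale c (x + y) = hscale c x + hscale c y"
    and hscale_add_left: "hscale (c + e) x = hscale c x + hscale e x"
    and hscale_hscale: "hscale c (hscale e x) = hscale (c * e) x"
    and hscale_one: "hscale 1 x = x"
    and hinner_add_right: "hinner x (y + z) = hinner x y + hinner x z"
    and hinner_scale_right: "hinner x (hscale c y) = c * hinner x y"
    and hinner_cnj: "hinner y x = cnj (hinner x y)"
    and hinner_pos: "Im (hinner x x) = 0 \<and> Re (hinner x x) \<ge> 0"
    and hinner_definite: "hinner x x = 0 \<Longrightarrow> x = 0"
    and hcomplete: "(\<forall>\<epsilon>>0. \<exists>N. \<forall>m\<ge>N. \<forall>n\<ge>N.
                       sqrt (Re (hinner (f m - f n) (f m - f n))) < \<epsilon>) \<Longrightarrow>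
                    \<exists>l. (\<lambda>n. sqrt (Re (hinner (f n - l) (f n - l)))) \<longlonglongrightarrow> 0"

definition hnorm :: "'h::chilbert \<Rightarrow> real" where
  "hnorm x = sqrt (Re (hinner x x))"

definition faithful_star_rep :: "('b::star_algebra \<Rightarrow> 'h::chilbert \<Rightarrow> 'h) \<Rightarrow> bool" where
  "faithful_star_rep \<pi> \<longleftrightarrow>
     (\<forall>b x y. \<pi> b (x + y) = \<pi> b x + \<pi> b y) \<and>
     (\<forall>b c x. \<pi> b (hscale c x) = hscale c (\<pi> b x)) \<and>
     (\<forall>b. \<exists>K. \<forall>x. hnorm (\<pi> b x) \<le> K * hnorm x) \<and>
     (\<forall>b c x. \<pi> (b + c) x = \<pi> b x + \<pi> c x) \<and>
     (\<forall>b c x. \<pi> (cscale c b) x = hscale c (\<pi> b x)) \<and>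
     (\<forall>b c x. \<pi> (b * c) x = \<pi> b (\<pi> c x)) \<and>
     (\<forall>x. \<pi> 1 x = x) \<and>
     (\<forall>b x y. hinner (\<pi> b x) y = hinner x (\<pi> (sadj b) y)) \<and>
     inj \<pi>"

definition ncps :: "('a::star_algebra \<Rightarrow> complex) \<Rightarrow> bool" where
  "ncps \<phi> \<longleftrightarrow>
     (\<forall>x y. \<phi> (x + y) = \<phi> x + \<phi> y) \<and> (\<forall>c x. \<phi> (cscale c x) = c * \<phi> x) \<and>
     \<phi> 1 = 1 \<and> (\<forall>x. Im (\<phi> (sadj x * x)) = 0 \<and> Re (\<phi> (sadj x * x)) \<ge> 0)"

definition freely_independent ::
  "('a::star_algebra \<Rightarrow> complex) \<Rightarrow> nat \<Rightarrow> (nat \<Rightarrow> 'a) \<Rightarrow> bool" where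
  "freely_independent \<phi> d X \<longleftrightarrow>
     (\<forall>ks as. length as = length ks \<and> ks \<noteq> [] \<and>
        (\<forall>r<length ks. ks ! r \<in> {1..d} \<and> as ! r \<in> salg {X (ks ! r)} \<and> \<phi> (as ! r) = 0) \<and>
        (\<forall>r. Suc r < length ks \<longrightarrow> ks ! r \<noteq> ks ! Suc r)
      \<longrightarrow> \<phi> (prod_list as) = 0)"

definition noncrossing :: "nat set set \<Rightarrow> bool" where
  "noncrossing P \<longleftrightarrow>
     (\<forall>B1\<in>P. \<forall>B2\<in>P. B1 \<noteq> B2 \<longrightarrow>
        \<not> (\<exists>a b c e. a < b \<and> b < c \<and> c < e \<and> a \<in> B1 \<and> c \<in> B1 \<and> b \<in> B2 \<and> e \<in> B2))"

definition NC :: "nat \<Rightarrow> nat set set set" where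
  "NC m = {P. partition_on {..<m} P \<and> noncrossing P}"

text \<open>\<open>\<kappa>\<close> is the family of scalar free cumulants of \<open>(\<A>,\<phi>)\<close>: \<open>\<kappa> [a1,...,an]\<close> is
  \<open>\<kappa>_n(a1,...,an)\<close>, characterised by the moment-cumulant formula (which determines
  \<open>\<kappa>\<close> uniquely on non-empty lists).\<close>
definition free_cumulants :: "('a::star_algebra \<Rightarrow> complex) \<Rightarrow> ('a list \<Rightarrow> complex) \<Rightarrow> bool" where
  "free_cumulants \<phi> \<kappa> \<longleftrightarrow>
     (\<forall>as. \<phi> (prod_list as) = (\<Sum>P\<in>NC (length as). \<Prod>B\<in>P. \<kappa> (nths as B)))"

text \<open>A word \<open>b0 Y_{j1} b1 \<dots>\<close> in \<open>\<A> \<otimes> \<B>\<close> is a list of letters: \<open>LB b\<close> stands for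
  \<open>1 \<otimes> b\<close>, \<open>LY j\<close> for \<open>Y_j = \<Sum>_i X_i \<otimes> u_{ij}\<close>; products are concatenations.\<close>
datatype 'b letter = LB 'b | LY nat

text \<open>\<open>Ew \<phi> X u d x b w = E((x \<otimes> b) \<cdot> w)\<close> where \<open>E = \<phi> \<otimes> id\<close>.\<close>
fun Ew :: "('a::star_algebra \<Rightarrow> complex) \<Rightarrow> (nat \<Rightarrow> 'a) \<Rightarrow> (nat \<Rightarrow> nat \<Rightarrow> 'b::star_algebra)
           \<Rightarrow> nat \<Rightarrow> 'a \<Rightarrow> 'b \<Rightarrow> 'b letter list \<Rightarrow> 'b" where
  "Ew \<phi> X u d x b [] = cscale (\<phi> x) b"
| "Ew \<phi> X u d x b (LB c # w) = Ew \<phi> X u d x (b * c) w"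
| "Ew \<phi> X u d x b (LY j # w) = (\<Sum>i\<in>{1..d}. Ew \<phi> X u d (x * X i) (b * u i j) w)"

definition Esum :: "('a::star_algebra \<Rightarrow> complex) \<Rightarrow> (nat \<Rightarrow> 'a) \<Rightarrow> (nat \<Rightarrow> nat \<Rightarrow> 'b::star_algebra)
           \<Rightarrow> nat \<Rightarrow> 'b letter list list \<Rightarrow> 'b" where
  "Esum \<phi> X u d ws = (\<Sum>w\<leftarrow>ws. Ew \<phi> X u d 1 1 w)"

text \<open>Every element of the (*-)algebra generated by \<open>1 \<otimes> \<B>\<close> and \<open>Y_k\<close> is a finite sum of
  words using only \<open>B\<close>-letters and \<open>Y_k\<close>; the product of such sums is the sum of all
  concatenations. Freeness with amalgamation over \<open>\<B>\<close> of \<open>Y_1,\<dots>,Y_d\<close> w.r.t. \<open>E\<close>:\<close>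
definition amalg_free_Y ::
  "('a::star_algebra \<Rightarrow> complex) \<Rightarrow> (nat \<Rightarrow> 'a) \<Rightarrow> (nat \<Rightarrow> nat \<Rightarrow> 'b::star_algebra) \<Rightarrow> nat \<Rightarrow> bool" where
  "amalg_free_Y \<phi> X u d \<longleftrightarrow>
     (\<forall>ks (as :: 'b letter list list list). length as = length ks \<and> ks \<noteq> [] \<and>
        (\<forall>r<length ks. ks ! r \<in> {1..d} \<and>
            (\<forall>w\<in>set (as ! r). \<forall>l\<in>set w. l \<in> range LB \<or> l = LY (ks ! r)) \<and>
            Esum \<phi> X u d (as ! r) = 0) \<and>
        (\<forall>r. Suc r < length ks \<longrightarrow> ks ! r \<noteq> ks ! Suc r)
      \<longrightarrow> Esum \<phi> X u d (map concat (product_lists as)) = 0)"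

text \<open>A surjective unital *-homomorphism \<open>\<beta> : Pol(O_d^+) \<rightarrow> \<B>\<close> is the same as a family
  \<open>u_{ij} = \<beta>(u_{ij})\<close> of self-adjoint elements satisfying the defining relations of
  \<open>Pol(O_d^+)\<close> and generating \<open>\<B>\<close> (universal property).\<close>
definition orth_quantum_matrix :: "nat \<Rightarrow> (nat \<Rightarrow> nat \<Rightarrow> 'b::star_algebra) \<Rightarrow> bool" where
  "orth_quantum_matrix d u \<longleftrightarrow>
     (\<forall>i\<in>{1..d}. \<forall>j\<in>{1..d}. sadj (u i j) = u i j) \<and>
     (\<forall>j\<in>{1..d}. \<forall>j'\<in>{1..d}. (\<Sum>i\<in>{1..d}. u i j * u i j') = (if j = j' then 1 else 0)) \<and>
     (\<forall>i\<in>{1..d}. \<forall>i'\<in>{1..d}. (\<Sum>j\<in>{1..d}. u i j * u i' j) = (if i = i' then 1 else 0)) \<and>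
     (\<forall>b. b \<in> salg {u i j | i j. i \<in> {1..d} \<and> j \<in> {1..d}})"

end

theory Submission
  imports Defs
begin

text \<open>
  After centring the \<open>X\<^sub>i\<close>, let \<open>m\<close> be their moment sequence. They are semicircular iff
  \<open>m (k + 1) = m 2 \<Sum>\<^sub>q\<^sub><\<^sub>k m q m (k - 1 - q)\<close> for all \<open>k\<close>. Otherwise let \<open>N \<ge> 2\<close> be the least \<open>k\<close>
  where this fails, with defect \<open>c \<noteq> 0\<close>. By freeness, mixed moments of length at most \<open>N + 1\<close>
  obey the Schwinger-Dyson equation of a free semicircular family, up to the defect \<open>c\<close> for the
  words \<open>X\<^sub>i\<^sup>N\<^sup>+\<^sup>1\<close>. Orthogonality of \<open>u\<close> preserves that equation: the moments
  \<open>E(Y\<^bsub>j(1)\<^esub> \<cdots> Y\<^bsub>j(n)\<^esub>)\<close> are semicircular for \<open>n \<le> N\<close>, and for \<open>n = N + 1\<close> there is the additional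
  term \<open>c \<Sum>\<^sub>i u\<^bsub>i j(1)\<^esub> \<cdots> u\<^bsub>i j(n)\<^esub>\<close>. On the word \<open>Y\<^sub>j Y\<^sub>k\<^sup>N\<^sup>-\<^sup>1 Y\<^sub>l\<close> with \<open>j \<noteq> k\<close>, freeness with
  amalgamation yields the semicircular moment alone, hence \<open>\<Sum>\<^sub>i u\<^sub>i\<^sub>j u\<^sub>i\<^sub>k\<^sup>N\<^sup>-\<^sup>1 u\<^sub>i\<^sub>l = 0\<close> for all
  \<open>l\<close>. By orthogonality of the rows this gives \<open>u\<^sub>i\<^sub>j u\<^sub>i\<^sub>k\<^sup>N\<^sup>-\<^sup>1 = 0\<close>. A self-adjoint operator has
  the same kernel as its positive powers, so \<open>u\<^sub>i\<^sub>k u\<^sub>i\<^sub>j = 0\<close>, and \<open>\<Sum>\<^sub>l u\<^sub>i\<^sub>l\<^sup>2 = 1\<close> turns this into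
  \<open>u\<^sub>i\<^sub>k\<^sup>2 = u\<^sub>i\<^sub>k\<^sup>4\<close>.
\<close>

section \<open>Non-crossing partitions and free cumulants\<close>

definition NC_on :: "nat set \<Rightarrow> nat set set set" where
  "NC_on A = {P. partition_on A P \<and> noncrossing P}"

definition block_weight :: "(nat \<Rightarrow> 'c::comm_semiring_1) \<Rightarrow> nat set set \<Rightarrow> 'c" where
  "block_weight c P = (\<Prod>B\<in>P. c (card B))"

definition NC_sum :: "(nat \<Rightarrow> 'c::comm_semiring_1) \<Rightarrow> nat set \<Rightarrow> 'c" where
  "NC_sum c A = (\<Sum>P\<in>NC_on A. block_weight c P)"

lemma NC_eq_NC_on: "NC m = NC_on {..<m}"
  by (simp add: NC_def NC_on_def)

lemma NC_onD:
  assumes "P \<in> NC_on A"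
  shows "partition_on A P" "noncrossing P"
  using assms by (simp_all add: NC_on_def)

lemma NC_on_block:
  assumes "P \<in> NC_on A" "B \<in> P"
  shows "B \<subseteq> A" "B \<noteq> {}"
  using assms by (auto simp: NC_on_def partition_on_def)

lemma NC_on_disjoint_blocks:
  assumes "P \<in> NC_on A" "B \<in> P" "C \<in> P" "B \<noteq> C"
  shows "B \<inter> C = {}"
  using assms by (auto simp: NC_on_def partition_on_def disjoint_def)

lemma finite_NC_on: "finite A \<Longrightarrow> finite (NC_on A)"
  using finitely_many_partition_on[of A] by (rule finite_subset[rotated]) (auto simp: NC_on_def)

lemma finite_NC_on_blocks: "P \<in> NC_on A \<Longrightarrow> finite A \<Longrightarrow> finite P"
  using finite_elements NC_onD(1) by blast

lemma NC_sum_empty: "NC_sum c {} = 1"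
proof -
  have "NC_on {} = {{}}" by (auto simp: NC_on_def partition_on_empty noncrossing_def)
  then show ?thesis by (simp add: NC_sum_def block_weight_def)
qed

definition crosses :: "nat set \<Rightarrow> nat set \<Rightarrow> bool" where
  "crosses B C \<longleftrightarrow> (\<exists>x y z t. x < y \<and> y < z \<and> z < t \<and> x \<in> B \<and> z \<in> B \<and> y \<in> C \<and> t \<in> C)"

lemma noncrossing_eq_pairwise: "noncrossing P \<longleftrightarrow> pairwise (\<lambda>B C. \<not> crosses B C) P"
  by (simp add: noncrossing_def pairwise_def crosses_def)

lemma crosses_mono: "crosses B C \<Longrightarrow> B \<subseteq> B' \<Longrightarrow> C \<subseteq> C' \<Longrightarrow> crosses B' C'"
  unfolding crosses_def by (meson subsetD)

lemma crosses_least_pair_iff: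
  assumes "\<forall>x\<in>C. a < x" "a \<le> b"
  shows "crosses {a, b} C \<longleftrightarrow> (\<exists>y\<in>C. \<exists>t\<in>C. y < b \<and> b < t)" "\<not> crosses C {a, b}"
  using assms by (auto simp: crosses_def)

lemma noncrossing_subset: "noncrossing P \<Longrightarrow> Q \<subseteq> P \<Longrightarrow> noncrossing Q"
  unfolding noncrossing_eq_pairwise by (rule pairwise_subset)

lemma NC_on_Un:
  assumes "A \<inter> B = {}" and cross: "\<not> crosses A B" "\<not> crosses B A"
    and Q_NC: "Q \<in> NC_on A" and R_NC: "R \<in> NC_on B"
  shows "Q \<union> R \<in> NC_on (A \<union> B)"
proof -
  have "partition_on (A \<union> B) (Q \<union> R)"
    using assms(1) NC_onD(1)[OF Q_NC] NC_onD(1)[OF R_NC]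
    by (auto simp: partition_on_def intro: disjoint_union)
  moreover have "\<not> crosses C D" "\<not> crosses D C" if "C \<in> Q" "D \<in> R" for C D
    using cross crosses_mono NC_on_block(1)[OF Q_NC that(1)] NC_on_block(1)[OF R_NC that(2)]
    by blast+
  then have "noncrossing (Q \<union> R)"
    using NC_onD(2)[OF Q_NC] NC_onD(2)[OF R_NC] unfolding noncrossing_eq_pairwise pairwise_def
    by blast
  ultimately show ?thesis by (simp add: NC_on_def)
qed

lemma NC_on_Int_Pow:
  assumes P_NC: "P \<in> NC_on S" and "A \<subseteq> S" and split: "\<forall>C\<in>P. C \<subseteq> A \<or> C \<inter> A = {}"
  shows "P \<inter> Pow A \<in> NC_on A"
proof -
  have "\<Union>(P \<inter> Pow A) = A"
  proof (intro equalityI subsetI)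
    fix x assume "x \<in> A"
    then obtain C where "C \<in> P" "x \<in> C"
      using partition_onD1[OF NC_onD(1)[OF P_NC]] assms(2) by blast
    then show "x \<in> \<Union>(P \<inter> Pow A)" using split \<open>x \<in> A\<close> by blast
  qed auto
  moreover have "disjoint (P \<inter> Pow A)"
    using partition_onD2[OF NC_onD(1)[OF P_NC]] by (rule pairwise_subset) simp
  moreover have "{} \<notin> P \<inter> Pow A"
    using NC_on_block(2)[OF P_NC] by blast
  moreover have "noncrossing (P \<inter> Pow A)"
    using NC_onD(2)[OF P_NC] by (rule noncrossing_subset) simp
  ultimately show ?thesis by (simp add: NC_on_def partition_on_def)
qed

lemma bij_betw_NC_on_Un:
  assumes disj: "A \<inter> B = {}" and "\<not> crosses A B" "\<not> crosses B A"
  shows "bij_betw (\<lambda>(Q, R). Q \<union> R) (NC_on A \<times> NC_on B)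
    {P \<in> NC_on (A \<union> B). \<forall>C\<in>P. C \<subseteq> A \<or> C \<subseteq> B}"
proof (rule bij_betw_byWitness[where f' = "\<lambda>P. (P \<inter> Pow A, P \<inter> Pow B)"])
  have "(Q \<union> R) \<inter> Pow A = Q \<and> (Q \<union> R) \<inter> Pow B = R"
    if "Q \<in> NC_on A" "R \<in> NC_on B" for Q R
    using NC_on_block[OF that(1)] NC_on_block[OF that(2)] disj by fastforce
  then show "\<forall>QR\<in>NC_on A \<times> NC_on B.
      (\<lambda>P. (P \<inter> Pow A, P \<inter> Pow B)) ((\<lambda>(Q, R). Q \<union> R) QR) = QR"
    by auto
  have "Q \<union> R \<in> {P \<in> NC_on (A \<union> B). \<forall>C\<in>P. C \<subseteq> A \<or> C \<subseteq> B}"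
    if "Q \<in> NC_on A" "R \<in> NC_on B" for Q R
    using NC_on_Un[OF assms that] NC_on_block(1)[OF that(1)] NC_on_block(1)[OF that(2)] by blast
  then show "(\<lambda>(Q, R). Q \<union> R) ` (NC_on A \<times> NC_on B) \<subseteq>
      {P \<in> NC_on (A \<union> B). \<forall>C\<in>P. C \<subseteq> A \<or> C \<subseteq> B}"
    by auto
  show "(\<lambda>P. (P \<inter> Pow A, P \<inter> Pow B)) ` {P \<in> NC_on (A \<union> B). \<forall>C\<in>P. C \<subseteq> A \<or> C \<subseteq> B}
      \<subseteq> NC_on A \<times> NC_on B"
  proof (rule image_subsetI, intro SigmaI)
    fix P assume "P \<in> {P \<in> NC_on (A \<union> B). \<forall>C\<in>P. C \<subseteq> A \<or> C \<subseteq> B}"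
    then have P_NC: "P \<in> NC_on (A \<union> B)" and split: "\<forall>C\<in>P. C \<subseteq> A \<or> C \<subseteq> B" by auto
    show "P \<inter> Pow A \<in> NC_on A"
      using split disj by (intro NC_on_Int_Pow[OF P_NC]) auto
    show "P \<inter> Pow B \<in> NC_on B"
      using split disj by (intro NC_on_Int_Pow[OF P_NC]) auto
  qed
qed auto

lemma NC_sum_mult:
  assumes "finite A" "finite B" and disj: "A \<inter> B = {}"
    and cross: "\<not> crosses A B" "\<not> crosses B A"
  shows "NC_sum c A * NC_sum c B =
    (\<Sum>P\<in>{P \<in> NC_on (A \<union> B). \<forall>C\<in>P. C \<subseteq> A \<or> C \<subseteq> B}. block_weight c P)"
proof -
  have "block_weight c Q * block_weight c R = block_weight c (Q \<union> R)"
    if "Q \<in> NC_on A" "R \<in> NC_on B" for Q R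
    unfolding block_weight_def
  proof (rule prod.union_disjoint[symmetric])
    show "Q \<inter> R = {}"
      using NC_on_block[OF that(1)] NC_on_block[OF that(2)] disj
      by (meson disjoint_iff subset_empty subset_iff le_infI)
  qed (use finite_NC_on_blocks that assms in auto)
  then have "NC_sum c A * NC_sum c B =
      (\<Sum>(Q, R)\<in>NC_on A \<times> NC_on B. block_weight c (Q \<union> R))"
    unfolding NC_sum_def sum_product sum.cartesian_product by (intro sum.cong) auto
  also have "\<dots> = (\<Sum>P\<in>{P \<in> NC_on (A \<union> B). \<forall>C\<in>P. C \<subseteq> A \<or> C \<subseteq> B}. block_weight c P)"
    using sum.reindex_bij_betw[OF bij_betw_NC_on_Un[OF disj cross], of "block_weight c"]
    by (simp add: case_prod_unfold)
  finally show ?thesis .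
qed

lemma bij_betw_insert_block:
  assumes "V \<subseteq> A" "V \<noteq> {}"
  shows "bij_betw (insert V) {Q \<in> NC_on (A - V). noncrossing (insert V Q)} {P \<in> NC_on A. V \<in> P}"
proof (rule bij_betw_byWitness[where f' = "\<lambda>P. P - {V}"])
  have "V \<notin> Q" if "Q \<in> NC_on (A - V)" for Q
    using NC_on_block(1)[OF that] assms(2) by blast
  then show "\<forall>Q\<in>{Q \<in> NC_on (A - V). noncrossing (insert V Q)}. insert V Q - {V} = Q"
    by auto
  have disj: "disjnt V (\<Union>Q)" if "Q \<in> NC_on (A - V)" for Q
    using NC_on_block(1)[OF that] by (auto simp: disjnt_def)
  show "insert V ` {Q \<in> NC_on (A - V). noncrossing (insert V Q)} \<subseteq> {P \<in> NC_on A. V \<in> P}"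
    using assms partition_on_insert[OF disj] by (auto simp: NC_on_def)
  show "(\<lambda>P. P - {V}) ` {P \<in> NC_on A. V \<in> P} \<subseteq>
      {Q \<in> NC_on (A - V). noncrossing (insert V Q)}"
  proof (rule image_subsetI)
    fix P assume "P \<in> {P \<in> NC_on A. V \<in> P}"
    then have P_NC: "P \<in> NC_on A" "V \<in> P" by auto
    then have "disjnt V (\<Union>(P - {V}))"
      using NC_on_disjoint_blocks[OF P_NC] by (auto simp: disjnt_def)
    then have "partition_on (A - V) (P - {V})"
      using partition_on_insert[of V "P - {V}" A] NC_onD(1)[OF P_NC(1)] P_NC(2)
      by (simp add: insert_absorb)
    then show "P - {V} \<in> {Q \<in> NC_on (A - V). noncrossing (insert V Q)}"
      using NC_onD(2)[OF P_NC(1)] P_NC(2)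
      by (auto simp: NC_on_def insert_absorb intro: noncrossing_subset)
  qed
qed auto

lemma noncrossing_insert_pair_iff:
  assumes Q_NC: "Q \<in> NC_on (insert a A - {a, b})" and least: "\<forall>x\<in>A. a < x"
    and b_mem: "b \<in> insert a A"
  shows "noncrossing (insert {a, b} Q) \<longleftrightarrow>
    (\<forall>C\<in>Q. C \<subseteq> {x \<in> A. x < b} \<or> C \<subseteq> {x \<in> A. b < x})"
proof -
  have "a \<le> b" using least b_mem by auto
  have "C \<noteq> {a, b} \<and> (crosses {a, b} C \<longleftrightarrow>
      \<not> (C \<subseteq> {x \<in> A. x < b} \<or> C \<subseteq> {x \<in> A. b < x})) \<and> \<not> crosses C {a, b}"
    if C_mem: "C \<in> Q" for C
  proof -
    have "C \<subseteq> A - {a, b}" using NC_on_block(1)[OF Q_NC C_mem] by auto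
    moreover from this have "\<forall>x\<in>C. a < x" using least by blast
    note crosses_least_pair_iff[OF this \<open>a \<le> b\<close>]
    moreover have "x < b \<or> b < x" if "x \<in> C" for x
      using that calculation(1) by (auto simp: neq_iff)
    ultimately show ?thesis by auto
  qed
  moreover have "pairwise (\<lambda>B C. \<not> crosses B C) Q"
    using NC_onD(2)[OF Q_NC] by (simp only: noncrossing_eq_pairwise)
  ultimately show ?thesis
    unfolding noncrossing_eq_pairwise pairwise_insert by blast
qed

lemma sum_NC_on_first_block:
  assumes "finite A" and least: "\<forall>x\<in>A. a < x" and b_mem: "b \<in> insert a A"
  shows "(\<Sum>P\<in>{P \<in> NC_on (insert a A). {a, b} \<in> P}. block_weight c P) =
    c (card {a, b}) * (NC_sum c {x \<in> A. x < b} * NC_sum c {x \<in> A. b < x})"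
proof -
  let ?below = "{x \<in> A. x < b}" and ?above = "{x \<in> A. b < x}"
  let ?rest = "insert a A - {a, b}"
  have rest: "?rest = ?below \<union> ?above" using least b_mem by auto
  have "(\<Sum>P\<in>{P \<in> NC_on (insert a A). {a, b} \<in> P}. block_weight c P) =
      (\<Sum>Q\<in>{Q \<in> NC_on ?rest. noncrossing (insert {a, b} Q)}. block_weight c (insert {a, b} Q))"
    using b_mem by (intro sum.reindex_bij_betw[OF bij_betw_insert_block, symmetric]) auto
  also have "\<dots> = (\<Sum>Q\<in>{Q \<in> NC_on ?rest. noncrossing (insert {a, b} Q)}.
      c (card {a, b}) * block_weight c Q)"
  proof (intro sum.cong refl)
    fix Q assume "Q \<in> {Q \<in> NC_on ?rest. noncrossing (insert {a, b} Q)}"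
    then have Q_NC: "Q \<in> NC_on ?rest" by simp
    then have "{a, b} \<notin> Q" using NC_on_block(1) by blast
    then show "block_weight c (insert {a, b} Q) = c (card {a, b}) * block_weight c Q"
      using finite_NC_on_blocks[OF Q_NC] assms(1) by (simp add: block_weight_def)
  qed
  also have "\<dots> = c (card {a, b}) * (\<Sum>Q\<in>{Q \<in> NC_on ?rest.
      \<forall>C\<in>Q. C \<subseteq> ?below \<or> C \<subseteq> ?above}. block_weight c Q)"
    unfolding sum_distrib_left
    by (intro sum.cong refl Collect_cong conj_cong noncrossing_insert_pair_iff least b_mem)
  also have "\<dots> = c (card {a, b}) * (NC_sum c ?below * NC_sum c ?above)"
    unfolding rest using assms(1)
    by (subst NC_sum_mult) (auto simp: crosses_def)
  finally show ?thesis .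
qed

lemma block_weight_eq_zero_if_no_pair:
  assumes vanishing: "\<And>k. k \<ge> 3 \<Longrightarrow> c k = 0" and finite_A: "finite A"
    and P_NC: "P \<in> NC_on A" and "a \<in> A" and no_pair: "\<And>b. b \<in> A \<Longrightarrow> {a, b} \<notin> P"
  shows "block_weight c P = 0"
proof -
  obtain V where V_block: "V \<in> P" "a \<in> V"
    using partition_onD1[OF NC_onD(1)[OF P_NC]] \<open>a \<in> A\<close> by blast
  have "V \<subseteq> A" by (rule NC_on_block(1)[OF P_NC V_block(1)])
  have "V \<noteq> {a}" using no_pair[OF \<open>a \<in> A\<close>] V_block(1) by auto
  then obtain y where y_mem: "y \<in> V" "y \<noteq> a" using V_block(2) by blast
  then have "V \<noteq> {a, y}" using no_pair[of y] V_block(1) \<open>V \<subseteq> A\<close> by auto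
  then obtain z where z_mem: "z \<in> V" "z \<noteq> a" "z \<noteq> y" using V_block(2) y_mem(1) by blast
  have "card {a, y, z} \<le> card V"
    using V_block y_mem z_mem finite_A \<open>V \<subseteq> A\<close> by (intro card_mono) (auto intro: finite_subset)
  then have "c (card V) = 0" using vanishing y_mem z_mem by simp
  then show ?thesis
    using V_block(1) finite_NC_on_blocks[OF P_NC finite_A]
    by (auto simp: block_weight_def intro!: prod_zero)
qed

lemma NC_sum_insert_least:
  assumes vanishing: "\<And>k. k \<ge> 3 \<Longrightarrow> c k = 0" and finite_A: "finite A" and least: "\<forall>x\<in>A. a < x"
  shows "NC_sum c (insert a A) =
    c 1 * NC_sum c A + c 2 * (\<Sum>b\<in>A. NC_sum c {x \<in> A. x < b} * NC_sum c {x \<in> A. b < x})"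
proof -
  let ?S = "\<lambda>b. {P \<in> NC_on (insert a A). {a, b} \<in> P}"
  have fin: "finite (NC_on (insert a A))" using finite_A by (simp add: finite_NC_on)
  have "NC_sum c (insert a A) = (\<Sum>P\<in>(\<Union>b\<in>insert a A. ?S b). block_weight c P)"
    unfolding NC_sum_def using finite_A
    by (intro sum.mono_neutral_right[OF fin] ballI
        block_weight_eq_zero_if_no_pair[where A = "insert a A" and a = a] vanishing) auto
  also have "\<dots> = (\<Sum>b\<in>insert a A. \<Sum>P\<in>?S b. block_weight c P)"
  proof (rule sum.UNION_disjoint)
    have "?S b \<inter> ?S b' = {}" if "b \<noteq> b'" for b b'
      using NC_on_disjoint_blocks[of _ "insert a A" "{a, b}" "{a, b'}"] that
      by (auto simp: doubleton_eq_iff)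
    then show "\<forall>b\<in>insert a A. \<forall>b'\<in>insert a A. b \<noteq> b' \<longrightarrow> ?S b \<inter> ?S b' = {}"
      by blast
  qed (use finite_A fin in auto)
  also have "\<dots> = (\<Sum>b\<in>insert a A.
      c (card {a, b}) * (NC_sum c {x \<in> A. x < b} * NC_sum c {x \<in> A. b < x}))"
    by (intro sum.cong refl sum_NC_on_first_block finite_A least)
  also have "\<dots> = c 1 * NC_sum c A +
      (\<Sum>b\<in>A. c 2 * (NC_sum c {x \<in> A. x < b} * NC_sum c {x \<in> A. b < x}))"
  proof -
    have "{x \<in> A. x < a} = {}" using least by force
    then have "NC_sum c {x \<in> A. x < a} = 1" by (simp only: NC_sum_empty)
    moreover have "{x \<in> A. a < x} = A" "a \<notin> A" using least by auto
    moreover have "card {a, b} = 2" if "b \<in> A" for b using least that by auto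
    ultimately show ?thesis using finite_A by simp
  qed
  finally show ?thesis by (simp add: sum_distrib_left)
qed

lemma sum_card_below_above:
  fixes A :: "'a::linorder set"
  assumes "finite A"
  shows "(\<Sum>b\<in>A. f (card {x \<in> A. x < b}) (card {x \<in> A. b < x})) =
    (\<Sum>q<card A. f q (card A - 1 - q))"
proof -
  let ?rank = "\<lambda>b. card {x \<in> A. x < b}"
  have mono: "?rank b < ?rank b'" if "b \<in> A" "b < b'" for b b'
    using assms that by (intro psubset_card_mono) auto
  have inj: "inj_on ?rank A"
    using mono by (intro linorder_inj_onI) (auto simp: less_imp_neq)
  have "?rank ` A \<subseteq> {..<card A}"
    using assms by (auto intro!: psubset_card_mono)
  then have "?rank ` A = {..<card A}"
    by (intro card_subset_eq) (simp_all add: card_image[OF inj])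
  with inj have bij: "bij_betw ?rank A {..<card A}" by (simp add: bij_betw_def)
  have "card {x \<in> A. b < x} = card A - 1 - ?rank b" if "b \<in> A" for b
  proof -
    have "{x \<in> A. b < x} = A - {b} - {x \<in> A. x < b}" by auto
    also have "card \<dots> = card (A - {b}) - ?rank b"
      using assms by (intro card_Diff_subset) auto
    finally show ?thesis using assms that by simp
  qed
  then have "(\<Sum>b\<in>A. f (?rank b) (card {x \<in> A. b < x})) =
      (\<Sum>b\<in>A. f (?rank b) (card A - 1 - ?rank b))"
    by (intro sum.cong refl) simp
  also have "\<dots> = (\<Sum>q<card A. f q (card A - 1 - q))"
    by (rule sum.reindex_bij_betw[OF bij])
  finally show ?thesis .
qed

lemma NC_sum_eq_moments:
  assumes vanishing: "\<And>k. k \<ge> 3 \<Longrightarrow> c k = 0"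
    and recursion: "M 0 = 1" "\<And>k. M (Suc k) = c 1 * M k + c 2 * (\<Sum>q<k. M q * M (k - 1 - q))"
    and "finite A"
  shows "NC_sum c A = M (card A)"
  using \<open>finite A\<close>
proof (induction A rule: finite_psubset_induct)
  case (psubset A)
  show ?case
  proof (cases "A = {}")
    case True
    then show ?thesis by (simp add: NC_sum_empty recursion(1))
  next
    case False
    define a where "a = Min A"
    define B where "B = A - {a}"
    have "a \<in> A" using psubset.hyps False by (simp add: a_def)
    then have A_eq: "A = insert a B" "a \<notin> B" by (auto simp: B_def)
    have B_above: "finite B" "\<forall>x\<in>B. a < x"
      using psubset.hyps Min_le[of A] by (auto simp: a_def B_def order.strict_iff_order)
    have NC_sum_subset: "NC_sum c C = M (card C)" if "C \<subseteq> B" for C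
      using that A_eq by (intro psubset.IH) auto
    have "NC_sum c A = c 1 * NC_sum c B +
        c 2 * (\<Sum>b\<in>B. NC_sum c {x \<in> B. x < b} * NC_sum c {x \<in> B. b < x})"
      unfolding A_eq(1) using vanishing B_above by (rule NC_sum_insert_least)
    also have "\<dots> = c 1 * M (card B) +
        c 2 * (\<Sum>b\<in>B. M (card {x \<in> B. x < b}) * M (card {x \<in> B. b < x}))"
      by (simp add: NC_sum_subset)
    also have "\<dots> = M (card A)"
      using A_eq B_above(1) recursion(2)[of "card B"]
        sum_card_below_above[OF B_above(1), of "\<lambda>q q'. M q * M q'"]
      by simp
    finally show ?thesis .
  qed
qed

lemma nths_replicate:
  assumes "B \<subseteq> {..<m}"
  shows "nths (replicate m x) B = replicate (card B) x"
proof (rule replicate_eqI)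
  have "{i. i < m \<and> i \<in> B} = B" using assms by auto
  then show "length (nths (replicate m x) B) = card B" by (simp add: length_nths)
  show "y = x" if "y \<in> set (nths (replicate m x) B)" for y
    using set_nths_subset[of "replicate m x" B] that by auto
qed

lemma sum_NC_on_remove_full_block:
  assumes "finite A" "A \<noteq> {}"
  shows "(\<Sum>P\<in>NC_on A. \<Prod>B\<in>P. g B) = g A + (\<Sum>P\<in>NC_on A - {{A}}. \<Prod>B\<in>P. g B)"
proof -
  have "{A} \<in> NC_on A"
    using partition_on_space[OF assms(2)] by (auto simp: NC_on_def noncrossing_def)
  then show ?thesis using finite_NC_on[OF assms(1)] by (subst sum.remove) auto
qed

lemma card_NC_on_block_less:
  assumes "finite A" and P_proper: "P \<in> NC_on A - {{A}}" and B_block: "B \<in> P"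
  shows "card B < card A"
proof -
  have "P \<in> NC_on A" using P_proper by simp
  note block = NC_on_block[OF this] and disj = NC_on_disjoint_blocks[OF this]
  have "B \<noteq> A"
  proof
    assume "B = A"
    then have "C = A" if "C \<in> P" for C
      using disj[OF that B_block] block[OF that] by blast
    then have "P = {A}" using B_block \<open>B = A\<close> by blast
    then show False using P_proper by simp
  qed
  then show ?thesis using block(1)[OF B_block] assms(1) by (intro psubset_card_mono) auto
qed

lemma free_cumulants_replicate_eq:
  assumes cumulants: "free_cumulants \<phi> \<kappa>"
    and moments: "\<And>k. NC_sum c {..<k} = \<phi> (x ^ k)" and "n \<ge> 1"
  shows "\<kappa> (replicate n x) = c n"
  using \<open>n \<ge> 1\<close>
proof (induction n rule: less_induct)
  case (less n)
  let ?proper = "NC_on {..<n} - {{{..<n}}}"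
  have nonempty: "{..<n} \<noteq> {}" using less.prems by (auto simp: lessThan_empty_iff)
  have "(\<Sum>P\<in>?proper. \<Prod>B\<in>P. \<kappa> (nths (replicate n x) B)) = (\<Sum>P\<in>?proper. \<Prod>B\<in>P. c (card B))"
  proof (intro sum.cong prod.cong refl)
    fix P B assume P_proper: "P \<in> ?proper" and B_block: "B \<in> P"
    have "B \<subseteq> {..<n}" "B \<noteq> {}" using NC_on_block[of P "{..<n}" B] P_proper B_block by simp_all
    moreover from this have "finite B" by (simp add: finite_subset)
    ultimately have "card B \<ge> 1" by (simp add: Suc_le_eq card_gt_0_iff)
    then show "\<kappa> (nths (replicate n x) B) = c (card B)"
      using less.IH[of "card B"] card_NC_on_block_less[OF _ P_proper B_block] \<open>B \<subseteq> {..<n}\<close>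
      by (simp add: nths_replicate)
  qed
  moreover have "\<phi> (x ^ n) = (\<Sum>P\<in>NC_on {..<n}. \<Prod>B\<in>P. \<kappa> (nths (replicate n x) B))"
    using cumulants unfolding free_cumulants_def
    by (metis length_replicate prod_list_replicate NC_eq_NC_on)
  moreover have "\<phi> (x ^ n) = (\<Sum>P\<in>NC_on {..<n}. \<Prod>B\<in>P. c (card B))"
    unfolding moments[symmetric] NC_sum_def block_weight_def ..
  ultimately show ?case
    unfolding sum_NC_on_remove_full_block[OF finite_lessThan nonempty]
    by (simp add: nths_replicate)
qed

lemma free_cumulants_eq_zero_if_moment_recursion:
  assumes cumulants: "free_cumulants \<phi> \<kappa>" and "\<phi> 1 = 1"
    and recursion: "\<And>k. \<phi> (x ^ Suc k) =
      \<mu> * \<phi> (x ^ k) + \<sigma> * (\<Sum>q<k. \<phi> (x ^ q) * \<phi> (x ^ (k - 1 - q)))"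
    and "n \<ge> 3"
  shows "\<kappa> (replicate n x) = 0"
proof -
  define c where "c k = (if k = 1 then \<mu> else if k = 2 then \<sigma> else 0)" for k :: nat
  have "NC_sum c {..<k} = \<phi> (x ^ k)" for k
    using NC_sum_eq_moments[of c "\<lambda>k. \<phi> (x ^ k)" "{..<k}"] assms(2) recursion
    by (simp add: c_def)
  then show ?thesis
    using free_cumulants_replicate_eq[OF cumulants, of c x n] assms(4) by (simp add: c_def)
qed

section \<open>Linear functionals on words\<close>

text \<open>A linear functional on the free algebra is represented by its restriction \<open>f\<close> to words;
  \<open>eval_blocks c f\<close> is its value on a product of polynomials \<open>X\<^sub>b\<^sup>p - c p\<close>, one for each block
  \<open>(b, p)\<close>.\<close>

fun eval_blocks :: "(nat \<Rightarrow> 'r::comm_ring_1) \<Rightarrow> ('i list \<Rightarrow> 'r) \<Rightarrow> ('i \<times> nat) list \<Rightarrow> 'r" where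
  "eval_blocks c f [] = f []"
| "eval_blocks c f ((b, p) # bs) =
    eval_blocks c (\<lambda>w. f (replicate p b @ w)) bs - c p * eval_blocks c f bs"

definition block_word :: "('i \<times> nat) list \<Rightarrow> 'i list" where
  "block_word bs = concat (map (\<lambda>(b, p). replicate p b) bs)"

lemma block_word_simps [simp]:
  "block_word [] = []" "block_word ((b, p) # bs) = replicate p b @ block_word bs"
  by (simp_all add: block_word_def)

lemma ex_alternating_blocks:
  "\<exists>bs. block_word bs = w \<and> distinct_adj (map fst bs) \<and> fst ` set bs = set w \<and> 0 \<notin> snd ` set bs"
proof (induction w)
  case Nil
  show ?case by (intro exI[of _ "[]"]) simp
next
  case (Cons b w)
  then obtain bs where blocks: "block_word bs = w" "distinct_adj (map fst bs)"
      "fst ` set bs = set w" "0 \<notin> snd ` set bs"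
    by blast
  show ?case
  proof (cases "\<exists>p bs'. bs = (b, p) # bs'")
    case True
    then obtain p bs' where "bs = (b, p) # bs'" by blast
    then show ?thesis using blocks by (intro exI[of _ "(b, Suc p) # bs'"]) auto
  next
    case False
    then have "bs = [] \<or> b \<noteq> hd (map fst bs)" by (cases bs) auto
    then show ?thesis
      using blocks by (intro exI[of _ "(b, 1) # bs"]) (auto simp: distinct_adj_Cons)
  qed
qed

lemma eval_blocks_diff:
  "eval_blocks c (\<lambda>w. f w - r * g w) bs = eval_blocks c f bs - r * eval_blocks c g bs"
proof (induction bs arbitrary: f g)
  case (Cons block bs)
  obtain b p where "block = (b, p)" by (cases block)
  then show ?case by (simp add: Cons algebra_simps)
qed simp

lemma eval_blocks_add:
  "eval_blocks c (\<lambda>w. f w + g w) bs = eval_blocks c f bs + eval_blocks c g bs"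
  using eval_blocks_diff[of c f "-1" g bs] by simp

lemma eval_blocks_mult_left: "eval_blocks c (\<lambda>w. r * f w) bs = r * eval_blocks c f bs"
  using eval_blocks_diff[of c "\<lambda>_. 0" "- r" f bs] eval_blocks_diff[of c f 1 f bs] by simp

lemma eval_blocks_zero: "eval_blocks c (\<lambda>w. 0) bs = 0"
  using eval_blocks_mult_left[of c 0 "\<lambda>w. 0" bs] by simp

lemma eval_blocks_sum:
  "eval_blocks c (\<lambda>w. \<Sum>k\<in>K. f k w) bs = (\<Sum>k\<in>K. eval_blocks c (f k) bs)"
  by (induction K rule: infinite_finite_induct) (simp_all add: eval_blocks_zero eval_blocks_add)

lemma eval_blocks_eq_zero:
  assumes "\<And>v. set v \<subseteq> fst ` set bs \<Longrightarrow> length v \<le> length (block_word bs) \<Longrightarrow> f v = 0"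
  shows "eval_blocks c f bs = 0"
  using assms
proof (induction bs arbitrary: f)
  case (Cons block bs)
  obtain b p where block: "block = (b, p)" by (cases block)
  have "eval_blocks c (\<lambda>w. f (replicate p b @ w)) bs = 0" "eval_blocks c f bs = 0"
    by (rule Cons.IH, rule Cons.prems, force simp: block, simp add: block)+
  then show ?case by (simp add: block)
qed simp

lemma eval_blocks_eq_top_degree:
  assumes "0 \<notin> snd ` set bs"
    and "\<And>v. set v \<subseteq> fst ` set bs \<Longrightarrow> length v < length (block_word bs) \<Longrightarrow> f v = 0"
  shows "eval_blocks c f bs = f (block_word bs)"
  using assms
proof (induction bs arbitrary: f)
  case (Cons block bs)
  obtain b p where block: "block = (b, p)" by (cases block)
  have "eval_blocks c f bs = 0"
    by (rule eval_blocks_eq_zero, rule Cons.prems(2)) (use Cons.prems(1) in \<open>auto simp: block\<close>)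
  moreover have "eval_blocks c (\<lambda>w. f (replicate p b @ w)) bs = f (replicate p b @ block_word bs)"
    by (rule Cons.IH, use Cons.prems(1) in \<open>simp add: block\<close>, rule Cons.prems(2))
      (force simp: block)+
  ultimately show ?case by (simp add: block)
qed simp

text \<open>\<open>(g \<otimes> h)(\<partial>\<^sub>a w)\<close> for the free difference quotient \<open>\<partial>\<^sub>a\<close>.\<close>

definition free_dq :: "'i \<Rightarrow> ('i list \<Rightarrow> 'r) \<Rightarrow> ('i list \<Rightarrow> 'r) \<Rightarrow> 'i list \<Rightarrow> 'r::comm_ring_1" where
  "free_dq a g h w = (\<Sum>k<length w. if w ! k = a then g (take k w) * h (drop (Suc k) w) else 0)"

lemma free_dq_Nil [simp]: "free_dq a g h [] = 0"
  by (simp add: free_dq_def)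

lemma free_dq_Cons [simp]:
  "free_dq a g h (b # w) = (if b = a then g [] * h w else 0) + free_dq a (\<lambda>v. g (b # v)) h w"
  by (simp add: free_dq_def sum.lessThan_Suc_shift del: sum.lessThan_Suc cong: if_cong)

lemma free_dq_diff_left:
  "free_dq a (\<lambda>v. g v - r * g' v) h w = free_dq a g h w - r * free_dq a g' h w"
  by (simp add: free_dq_def sum_subtractf[symmetric] sum_distrib_left algebra_simps if_distrib
      cong: if_cong)

lemma free_dq_replicate_append:
  "free_dq a g h (replicate p b @ w) =
    (if b = a then \<Sum>q<p. g (replicate q a) * h (replicate (p - 1 - q) a @ w) else 0) +
    free_dq a (\<lambda>v. g (replicate p b @ v)) h w"
proof (induction p arbitrary: g)
  case (Suc p)
  then show ?case by (simp add: sum.lessThan_Suc_shift del: sum.lessThan_Suc)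
qed simp

lemma free_dq_replicate:
  "free_dq a g h (replicate p a) = (\<Sum>q<p. g (replicate q a) * h (replicate (p - 1 - q) a))"
  using free_dq_replicate_append[of a g h p a "[]"] by simp

lemma free_dq_append:
  "free_dq a g h (v @ w) = free_dq a g (\<lambda>v. h (v @ w)) v + free_dq a (\<lambda>w. g (v @ w)) h w"
  by (induction v arbitrary: g) simp_all

lemma free_dq_eq_zero: "a \<notin> set w \<Longrightarrow> free_dq a g h w = 0"
  by (induction w arbitrary: g) auto

lemma eval_blocks_free_dq:
  "eval_blocks c (free_dq a g h) bs = (\<Sum>r<length bs. if fst (bs ! r) = a then
    \<Sum>q<snd (bs ! r). eval_blocks c (\<lambda>w. g (w @ replicate q a)) (take r bs) *
      eval_blocks c (\<lambda>w. h (replicate (snd (bs ! r) - 1 - q) a @ w)) (drop (Suc r) bs) else 0)"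
proof (induction bs arbitrary: g)
  case (Cons block bs)
  obtain b p where block: "block = (b, p)" by (cases block)
  define g' where "g' v = g (replicate p b @ v) - c p * g v" for v
  have "eval_blocks c (free_dq a g h) (block # bs) =
      (if b = a then \<Sum>q<p. g (replicate q a) *
         eval_blocks c (\<lambda>w. h (replicate (p - 1 - q) a @ w)) bs else 0) +
      eval_blocks c (free_dq a g' h) bs"
    unfolding g'_def block eval_blocks.simps free_dq_replicate_append free_dq_diff_left
      eval_blocks_diff
    by (simp add: eval_blocks_add eval_blocks_sum eval_blocks_mult_left eval_blocks_zero
        algebra_simps)
  moreover have "eval_blocks c (\<lambda>w. g' (w @ v)) (take r bs) =
      eval_blocks c (\<lambda>w. g (w @ v)) (take (Suc r) (block # bs))" for r v
    by (simp add: g'_def block eval_blocks_diff)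
  ultimately show ?case
    unfolding Cons.IH
    by (simp add: block sum.lessThan_Suc_shift del: sum.lessThan_Suc cong: if_cong)
qed simp

section \<open>Star-algebras and non-commutative probability spaces\<close>

lemma cscale_zero_left [simp]: "cscale 0 (x::'a::star_algebra) = 0"
  using cscale_add_left[of 0 0 x] by simp

lemma cscale_zero_right [simp]: "cscale c (0::'a::star_algebra) = 0"
  using cscale_add_right[of c 0 "0::'a"] by simp

lemma cscale_minus_left: "cscale (- c) (x::'a::star_algebra) = - cscale c x"
  using cscale_add_left[of c "- c" x] by (simp add: minus_unique)

lemma cscale_sum_right: "cscale c (\<Sum>i\<in>A. f i :: 'a::star_algebra) = (\<Sum>i\<in>A. cscale c (f i))"
  by (induction A rule: infinite_finite_induct) (auto simp: cscale_add_right)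

lemma cscale_sum_left: "cscale (\<Sum>i\<in>A. f i) (x::'a::star_algebra) = (\<Sum>i\<in>A. cscale (f i) x)"
  by (induction A rule: infinite_finite_induct) (auto simp: cscale_add_left)

lemma cscale_eq_0_iff: "cscale c (x::'a::star_algebra) = 0 \<longleftrightarrow> c = 0 \<or> x = 0"
  using cscale_cscale[of "inverse c" c x] by (cases "c = 0") (auto simp: cscale_one)

lemma salg_diff: "x \<in> salg S \<Longrightarrow> y \<in> salg S \<Longrightarrow> x - y \<in> salg S"
  using salg_add[OF _ salg_scale[of y S "-1"], of x]
  by (simp add: cscale_minus_left cscale_one)

lemma salg_power: "x \<in> salg S \<Longrightarrow> x ^ n \<in> salg S"
  by (induction n) (auto intro: salg.intros)

lemma salg_diff_scalar: "x \<in> salg S \<Longrightarrow> x - cscale c 1 \<in> salg S"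
  by (intro salg_diff salg_scale salg_one)

lemma salg_least: "S \<subseteq> salg T \<Longrightarrow> salg S \<subseteq> salg T"
proof
  fix x assume "S \<subseteq> salg T" "x \<in> salg S"
  from this(2,1) show "x \<in> salg T" by induction (auto intro: salg.intros)
qed

definition centred_power :: "(nat \<Rightarrow> complex) \<Rightarrow> ('i \<Rightarrow> 'a::star_algebra) \<Rightarrow> 'i \<times> nat \<Rightarrow> 'a" where
  "centred_power c X = (\<lambda>(b, p). X b ^ p - cscale (c p) 1)"

locale ncp_space =
  fixes \<phi> :: "'a::star_algebra \<Rightarrow> complex"
  assumes ncps: "ncps \<phi>"
begin

lemma phi_add: "\<phi> (x + y) = \<phi> x + \<phi> y"
  and phi_scale: "\<phi> (cscale c x) = c * \<phi> x"
  and phi_one: "\<phi> 1 = 1"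
  using ncps by (auto simp: ncps_def)

lemma phi_diff: "\<phi> (x - y) = \<phi> x - \<phi> y"
  using phi_add[of "x - y" y] by simp

definition word_moment :: "('i \<Rightarrow> 'a) \<Rightarrow> 'i list \<Rightarrow> complex" where
  "word_moment X w = \<phi> (prod_list (map X w))"

lemma eval_blocks_phi:
  "eval_blocks c (\<lambda>w. \<phi> (x * prod_list (map X w) * y)) bs =
    \<phi> (x * prod_list (map (centred_power c X) bs) * y)"
proof (induction bs arbitrary: x)
  case (Cons block bs)
  obtain b p where block: "block = (b, p)" by (cases block)
  define Q where "Q = prod_list (map (centred_power c X) bs)"
  have "eval_blocks c (\<lambda>w. \<phi> (x * prod_list (map X w) * y)) (block # bs) =
      \<phi> (x * X b ^ p * Q * y) - c p * \<phi> (x * Q * y)"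
    using Cons[of "x * X b ^ p"] Cons[of x] by (simp add: block Q_def mult.assoc)
  also have "\<dots> = \<phi> (x * X b ^ p * Q * y - cscale (c p) (x * Q * y))"
    by (simp add: phi_diff phi_scale)
  also have "x * X b ^ p * Q * y - cscale (c p) (x * Q * y) =
      x * (centred_power c X block * Q) * y"
    by (simp add: centred_power_def block algebra_simps cscale_mult_left cscale_mult_right)
  finally show ?case by (simp add: Q_def)
qed simp

lemma eval_blocks_word_moment:
  "eval_blocks c (word_moment X) bs = \<phi> (prod_list (map (centred_power c X) bs))"
  "eval_blocks c (\<lambda>w. word_moment X (b # w)) bs =
    \<phi> (X b * prod_list (map (centred_power c X) bs))"
  "eval_blocks c (\<lambda>w. word_moment X (replicate p b @ w)) bs =
    \<phi> (X b ^ p * prod_list (map (centred_power c X) bs))"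
  "eval_blocks c (\<lambda>w. word_moment X (w @ replicate p b)) bs =
    \<phi> (prod_list (map (centred_power c X) bs) * X b ^ p)"
  using eval_blocks_phi[of c 1 X 1 bs] eval_blocks_phi[of c "X b" X 1 bs]
    eval_blocks_phi[of c "X b ^ p" X 1 bs] eval_blocks_phi[of c 1 X "X b ^ p" bs]
  by (simp_all add: word_moment_def[abs_def])

lemma shifted_moments_cong:
  assumes "\<And>n. \<phi> (x ^ n) = \<phi> (y ^ n)"
  shows "\<phi> ((x - cscale \<mu> 1) ^ n) = \<phi> ((y - cscale \<mu> 1) ^ n)"
proof -
  have "\<phi> ((z - cscale \<mu> 1) ^ n) =
      eval_blocks (\<lambda>_. \<mu>) (\<lambda>w. \<phi> (z ^ length w)) (replicate n ((), 1))" for z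
    using eval_blocks_word_moment(1)[of "\<lambda>_. \<mu>" "\<lambda>_::unit. z" "replicate n ((), 1)"]
    by (simp add: centred_power_def word_moment_def[abs_def] map_replicate_const)
  then show ?thesis by (simp only: assms)
qed

text \<open>The recursion says \<open>\<phi>(y p(y)) = s (\<phi> \<otimes> \<phi>)(\<partial> p)\<close> for all polynomials \<open>p\<close>, and \<open>\<partial>\<close> is
  invariant under translations.\<close>

lemma moment_recursion_shift:
  assumes recursion: "\<And>k. \<phi> (y ^ Suc k) = s * (\<Sum>q<k. \<phi> (y ^ q) * \<phi> (y ^ (k - 1 - q)))"
    and x_eq: "x = y + cscale \<mu> 1"
  shows "\<phi> (x ^ Suc k) = \<mu> * \<phi> (x ^ k) + s * (\<Sum>q<k. \<phi> (x ^ q) * \<phi> (x ^ (k - 1 - q)))"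
proof -
  define M where "M w = word_moment (\<lambda>_. y) w" for w :: "unit list"
  let ?ev = "eval_blocks (\<lambda>_. - \<mu>)"
  let ?bs = "\<lambda>k. replicate k ((), Suc 0)"
  have M_eq: "M w = \<phi> (y ^ length w)" for w
    by (simp add: M_def word_moment_def map_replicate_const)
  have ev_M: "?ev M (?bs n) = \<phi> (x ^ n)" for n
    using eval_blocks_word_moment(1)[of "\<lambda>_. - \<mu>" "\<lambda>_. y" "?bs n"]
    by (simp add: M_def[abs_def] centred_power_def cscale_minus_left x_eq)
  have "M (() # w) = s * free_dq () M M w" for w
  proof -
    have "free_dq () M M w =
        (\<Sum>q<length w. M (replicate q ()) * M (replicate (length w - 1 - q) ()))"
      by (simp add: free_dq_def M_eq)
    then show ?thesis using recursion[of "length w"] by (simp add: M_eq)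
  qed
  then have "?ev (\<lambda>w. M (() # w)) (?bs k) = s * ?ev (free_dq () M M) (?bs k)"
    by (simp add: eval_blocks_mult_left)
  moreover have "?ev (\<lambda>w. M (() # w)) (?bs k) = \<phi> (y * x ^ k)"
    using eval_blocks_word_moment(2)[of "\<lambda>_. - \<mu>" "\<lambda>_. y" "()" "?bs k"]
    by (simp add: M_def[abs_def] centred_power_def cscale_minus_left x_eq)
  moreover have "?ev (free_dq () M M) (?bs k) = (\<Sum>q<k. \<phi> (x ^ q) * \<phi> (x ^ (k - 1 - q)))"
    by (simp add: eval_blocks_free_dq ev_M)
  moreover have "\<phi> (x ^ Suc k) = \<mu> * \<phi> (x ^ k) + \<phi> (y * x ^ k)"
    by (simp add: x_eq distrib_right cscale_mult_left phi_add phi_scale)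
  ultimately show ?thesis by simp
qed

end

section \<open>Mixed moments of a free family\<close>

definition semicircle_defect :: "(nat \<Rightarrow> 'r::comm_ring_1) \<Rightarrow> nat \<Rightarrow> 'r" where
  "semicircle_defect m k = m (Suc k) - m 2 * (\<Sum>q<k. m q * m (k - 1 - q))"

lemma (in ncp_space) free_cumulants_eq_zero_if_no_defect:
  assumes "free_cumulants \<phi> \<kappa>" and "\<And>k. semicircle_defect (\<lambda>k. \<phi> ((x - cscale \<mu> 1) ^ k)) k = 0"
    and "n \<ge> 3"
  shows "\<kappa> (replicate n x) = 0"
proof (rule free_cumulants_eq_zero_if_moment_recursion[OF assms(1) phi_one _ assms(3)])
  show "\<phi> (x ^ Suc k) = \<mu> * \<phi> (x ^ k) +
      \<phi> ((x - cscale \<mu> 1)\<^sup>2) * (\<Sum>q<k. \<phi> (x ^ q) * \<phi> (x ^ (k - 1 - q)))" for k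
    by (rule moment_recursion_shift[where y = "x - cscale \<mu> 1"])
      (use assms(2) in \<open>simp_all add: semicircle_defect_def\<close>)
qed

lemma freely_independent_salg:
  assumes "freely_independent \<phi> d X" "\<And>i. i \<in> {1..d} \<Longrightarrow> Y i \<in> salg {X i}"
  shows "freely_independent \<phi> d Y"
proof -
  have "y \<in> salg {X i}" if "y \<in> salg {Y i}" "i \<in> {1..d}" for y i
    using salg_least[of "{Y i}" "{X i}"] assms(2) that by blast
  then show ?thesis
    using assms(1) unfolding freely_independent_def by meson
qed

locale free_family = ncp_space \<phi> for \<phi> :: "'a::star_algebra \<Rightarrow> complex" +
  fixes d :: nat and X :: "nat \<Rightarrow> 'a"
  assumes free: "freely_independent \<phi> d X"
begin

definition alternating_centred :: "(nat \<times> 'a) list \<Rightarrow> bool" where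
  "alternating_centred l \<longleftrightarrow> distinct_adj (map fst l) \<and>
    (\<forall>(k, y)\<in>set l. k \<in> {1..d} \<and> y \<in> salg {X k} \<and> \<phi> y = 0)"

lemma phi_alternating:
  assumes "alternating_centred l" "l \<noteq> []"
  shows "\<phi> (prod_list (map snd l)) = 0"
proof -
  have "l ! r \<in> set l" if "r < length l" for r using that by simp
  then have "\<forall>r<length (map fst l). map fst l ! r \<in> {1..d} \<and>
      map snd l ! r \<in> salg {X (map fst l ! r)} \<and> \<phi> (map snd l ! r) = 0"
    using assms(1) unfolding alternating_centred_def by (force simp: case_prod_unfold)
  moreover have "\<forall>r. Suc r < length (map fst l) \<longrightarrow> map fst l ! r \<noteq> map fst l ! Suc r"
    using assms(1) unfolding alternating_centred_def distinct_adj_conv_nth by blast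
  ultimately show ?thesis
    using free assms(2) unfolding freely_independent_def by (metis length_map map_is_Nil_conv)
qed

lemma phi_mult_alternating:
  assumes alternating: "alternating_centred l" "l \<noteq> []"
    and letter: "k \<in> {1..d}" "k \<noteq> fst (hd l)" and y_salg: "y \<in> salg {X k}"
  shows "\<phi> (y * prod_list (map snd l)) = 0"
proof -
  let ?y = "y - cscale (\<phi> y) 1"
  have "alternating_centred ((k, ?y) # l)"
    using alternating letter y_salg unfolding alternating_centred_def
    by (auto simp: distinct_adj_Cons hd_map salg_diff_scalar phi_diff phi_scale phi_one)
  then have "\<phi> (?y * prod_list (map snd l)) = 0"
    using phi_alternating by fastforce
  then show ?thesis
    using phi_alternating[OF alternating]
    by (simp add: left_diff_distrib cscale_mult_left phi_diff phi_scale)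
qed

lemma phi_alternating_mult:
  assumes alternating: "alternating_centred l" "l \<noteq> []"
    and letter: "k \<in> {1..d}" "k \<noteq> fst (last l)" and y_salg: "y \<in> salg {X k}"
  shows "\<phi> (prod_list (map snd l) * y) = 0"
proof -
  let ?y = "y - cscale (\<phi> y) 1"
  have "alternating_centred (l @ [(k, ?y)])"
    using alternating letter y_salg unfolding alternating_centred_def
    by (auto simp: distinct_adj_append_iff last_map salg_diff_scalar phi_diff phi_scale phi_one)
  then have "\<phi> (prod_list (map snd l) * ?y) = 0"
    using phi_alternating[of "l @ [(k, ?y)]"] by simp
  then show ?thesis
    using phi_alternating[OF alternating]
    by (simp add: right_diff_distrib cscale_mult_right phi_diff phi_scale)
qed

end

locale centred_iid_family = free_family \<phi> d X
  for \<phi> :: "'a::star_algebra \<Rightarrow> complex" and d and X :: "nat \<Rightarrow> 'a" +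
  fixes m :: "nat \<Rightarrow> complex"
  assumes moments: "i \<in> {1..d} \<Longrightarrow> \<phi> (X i ^ k) = m k"
    and centred: "m 1 = 0"
begin

abbreviation moment :: "nat list \<Rightarrow> complex" where
  "moment \<equiv> word_moment X"

abbreviation block_prod :: "(nat \<times> nat) list \<Rightarrow> 'a" where
  "block_prod bs \<equiv> prod_list (map (centred_power m X) bs)"

definition alternating_blocks :: "(nat \<times> nat) list \<Rightarrow> bool" where
  "alternating_blocks bs \<longleftrightarrow> distinct_adj (map fst bs) \<and> fst ` set bs \<subseteq> {1..d}"

lemma moment_replicate: "i \<in> {1..d} \<Longrightarrow> moment (replicate k i) = m k"
  by (simp add: word_moment_def moments)

lemma centred_power_salg: "centred_power m X (b, p) \<in> salg {X b}"
  by (auto simp: centred_power_def intro: salg_diff_scalar salg_power salg_gen)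

lemma alternating_centred_blocks:
  assumes "alternating_blocks bs"
  shows "alternating_centred (map (\<lambda>block. (fst block, centred_power m X block)) bs)"
proof -
  have "\<phi> (centred_power m X (b, p)) = 0" if "b \<in> {1..d}" for b p
    using that by (simp add: centred_power_def phi_diff phi_scale phi_one moments)
  then show ?thesis
    using assms centred_power_salg
    by (auto simp: alternating_centred_def alternating_blocks_def comp_def)
qed

lemma phi_mult_blocks:
  assumes "alternating_blocks bs" "bs \<noteq> []" "b \<in> {1..d}" "b \<noteq> fst (hd bs)" "y \<in> salg {X b}"
  shows "\<phi> (y * block_prod bs) = 0"
  using phi_mult_alternating[OF alternating_centred_blocks, of bs b y] assms
  by (simp add: hd_map comp_def)

lemma phi_blocks_mult:
  assumes "alternating_blocks bs" "bs \<noteq> []" "b \<in> {1..d}" "b \<noteq> fst (last bs)" "y \<in> salg {X b}"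
  shows "\<phi> (block_prod bs * y) = 0"
  using phi_alternating_mult[OF alternating_centred_blocks, of bs b y] assms
  by (simp add: last_map comp_def)

lemma eval_blocks_free_dq_moment_eq_zero:
  assumes alternating: "alternating_blocks bs" and not_single: "\<And>p. bs \<noteq> [(a, p)]"
  shows "eval_blocks m (free_dq a moment moment) bs = 0"
  unfolding eval_blocks_free_dq
proof (rule sum.neutral, intro ballI)
  fix r assume "r \<in> {..<length bs}"
  then have r_less: "r < length bs" by simp
  obtain b p where block: "bs ! r = (b, p)" by (cases "bs ! r")
  have bs_split: "bs = take r bs @ (b, p) # drop (Suc r) bs"
    using id_take_nth_drop[OF r_less] block by simp
  then have alt: "alternating_blocks (take r bs @ (b, p) # drop (Suc r) bs)"
    using alternating by simp
  have power: "X b ^ q \<in> salg {X b}" for q by (intro salg_power salg_gen) simp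
  have "eval_blocks m (\<lambda>w. moment (w @ replicate q b)) (take r bs) *
      eval_blocks m (\<lambda>w. moment (replicate q' b @ w)) (drop (Suc r) bs) = 0" if "b = a" for q q'
  proof (cases "take r bs = []")
    case True
    then have "drop (Suc r) bs \<noteq> []" using not_single bs_split that by (metis append_Nil)
    then have "\<phi> (X b ^ q' * block_prod (drop (Suc r) bs)) = 0"
      using alt by (intro phi_mult_blocks[OF _ _ _ _ power])
        (auto simp: alternating_blocks_def distinct_adj_append_iff distinct_adj_Cons hd_map)
    then show ?thesis by (simp add: eval_blocks_word_moment)
  next
    case False
    then have "\<phi> (block_prod (take r bs) * X b ^ q) = 0"
      using alt by (intro phi_blocks_mult[OF _ _ _ _ power])
        (auto simp: alternating_blocks_def distinct_adj_append_iff last_map)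
    then show ?thesis by (simp add: eval_blocks_word_moment)
  qed
  then show "(if fst (bs ! r) = a then \<Sum>q<snd (bs ! r).
      eval_blocks m (\<lambda>w. moment (w @ replicate q a)) (take r bs) *
      eval_blocks m (\<lambda>w. moment (replicate (snd (bs ! r) - 1 - q) a @ w)) (drop (Suc r) bs)
      else 0) = 0"
    by (simp add: block del: mult_eq_0_iff)
qed

lemma eval_blocks_Cons_moment_eq_zero:
  assumes alternating: "alternating_blocks bs" "bs \<noteq> []" and letter: "a \<in> {1..d}"
    and not_single: "\<And>p. bs \<noteq> [(a, p)]"
  shows "eval_blocks m (\<lambda>w. moment (a # w)) bs = 0"
proof -
  obtain b p bs' where bs_Cons: "bs = (b, p) # bs'"
    using alternating(2) by (metis neq_Nil_conv surj_pair)
  have X_salg: "X a \<in> salg {X a}" by (intro salg_gen) simp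
  have "\<phi> (X a * block_prod bs) = 0"
  proof (cases "b = a")
    case True
    then have "bs' \<noteq> []" using not_single bs_Cons by blast
    moreover have "alternating_blocks bs'" "a \<noteq> fst (hd bs')"
      using alternating(1) calculation True
      by (auto simp: bs_Cons alternating_blocks_def distinct_adj_Cons hd_map)
    ultimately have "\<phi> (X a * centred_power m X (a, p) * block_prod bs') = 0"
      using letter X_salg centred_power_salg by (intro phi_mult_blocks[where b = a] salg_mult)
    then show ?thesis by (simp add: bs_Cons True mult.assoc)
  next
    case False
    then show ?thesis
      using alternating by (intro phi_mult_blocks[where b = a] letter X_salg) (auto simp: bs_Cons)
  qed
  then show ?thesis by (simp add: eval_blocks_word_moment)
qed

definition schwinger_dyson_defect :: "nat \<Rightarrow> nat list \<Rightarrow> complex" where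
  "schwinger_dyson_defect a w = moment (a # w) - m 2 * free_dq a moment moment w"

lemma schwinger_dyson_defect_replicate:
  assumes "a \<in> {1..d}"
  shows "schwinger_dyson_defect a (replicate k a) = semicircle_defect m k"
  using moment_replicate[OF assms, of "Suc k"]
  by (simp add: schwinger_dyson_defect_def semicircle_defect_def free_dq_replicate
      moment_replicate[OF assms])

lemma eval_blocks_schwinger_dyson_defect_eq_zero:
  assumes "alternating_blocks bs" "bs \<noteq> []" "a \<in> {1..d}" "\<And>p. bs \<noteq> [(a, p)]"
  shows "eval_blocks m (schwinger_dyson_defect a) bs = 0"
  unfolding schwinger_dyson_defect_def eval_blocks_diff
  using eval_blocks_Cons_moment_eq_zero[OF assms]
    eval_blocks_free_dq_moment_eq_zero[OF assms(1,4)] by simp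

text \<open>Modulo shorter words, on which the defect vanishes by induction, a word is the product of its
  centred blocks, for which both sides of the Schwinger-Dyson equation vanish by freeness.\<close>

lemma schwinger_dyson_defect_eq:
  assumes below: "\<And>k. k < N \<Longrightarrow> semicircle_defect m k = 0"
    and letter: "a \<in> {1..d}" and "set w \<subseteq> {1..d}" "length w \<le> N"
  shows "schwinger_dyson_defect a w = (if w = replicate N a then semicircle_defect m N else 0)"
  using assms(3,4)
proof (induction "length w" arbitrary: w rule: less_induct)
  case less
  show ?case
  proof (cases "w = replicate (length w) a")
    case True
    then have "schwinger_dyson_defect a w = semicircle_defect m (length w)"
      using schwinger_dyson_defect_replicate[OF letter] by metis
    then show ?thesis
      using True below[of "length w"] less.prems by (cases "length w = N") auto
  next
    case False
    obtain bs where blocks: "block_word bs = w" "distinct_adj (map fst bs)" "fst ` set bs = set w"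
        "0 \<notin> snd ` set bs"
      using ex_alternating_blocks[of w] by blast
    have lower: "schwinger_dyson_defect a v = 0" if "set v \<subseteq> set w" "length v < length w" for v
      using less.hyps[of v] less.prems that by auto
    have "eval_blocks m (schwinger_dyson_defect a) bs = schwinger_dyson_defect a (block_word bs)"
      by (rule eval_blocks_eq_top_degree[OF blocks(4)]) (simp add: lower blocks(1,3))
    moreover have "eval_blocks m (schwinger_dyson_defect a) bs = 0"
    proof (rule eval_blocks_schwinger_dyson_defect_eq_zero[OF _ _ letter])
      show "alternating_blocks bs" using blocks less.prems by (simp add: alternating_blocks_def)
      show "bs \<noteq> []" "bs \<noteq> [(a, p)]" for p using blocks(1) False by auto
    qed
    ultimately show ?thesis using False blocks(1) by auto
  qed
qed

end

section \<open>The coaction of an orthogonal quantum matrix\<close>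

text \<open>\<open>coact u d f w\<close> is the image of the word \<open>w\<close> under \<open>x\<^sub>j \<mapsto> \<Sum>\<^sub>i x\<^sub>i \<otimes> u\<^sub>i\<^sub>j\<close> followed by
  \<open>f \<otimes> id\<close>.\<close>

fun coact :: "(nat \<Rightarrow> nat \<Rightarrow> 'b::star_algebra) \<Rightarrow> nat \<Rightarrow> (nat list \<Rightarrow> complex) \<Rightarrow> nat list \<Rightarrow> 'b" where
  "coact u d f [] = cscale (f []) 1"
| "coact u d f (j # w) = (\<Sum>i\<in>{1..d}. u i j * coact u d (\<lambda>v. f (i # v)) w)"

lemma coact_cong:
  assumes "\<And>v. set v \<subseteq> {1..d} \<Longrightarrow> length v = length w \<Longrightarrow> f v = g v"
  shows "coact u d f w = coact u d g w"
  using assms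
proof (induction w arbitrary: f g)
  case (Cons j w)
  have "coact u d (\<lambda>v. f (i # v)) w = coact u d (\<lambda>v. g (i # v)) w" if "i \<in> {1..d}" for i
    using that by (intro Cons.IH Cons.prems) auto
  then show ?case by simp
qed simp

lemma coact_add: "coact u d (\<lambda>v. f v + g v) w = coact u d f w + coact u d g w"
  by (induction w arbitrary: f g) (simp_all add: cscale_add_left distrib_left sum.distrib)

lemma coact_mult_left: "coact u d (\<lambda>v. c * f v) w = cscale c (coact u d f w)"
  by (induction w arbitrary: f) (simp_all add: cscale_cscale cscale_mult_right cscale_sum_right)

lemma coact_zero: "coact u d (\<lambda>v. 0) w = 0"
  using coact_mult_left[of u d 0 "\<lambda>v. 0" w] by simp

lemma coact_single_constant_word:
  assumes "i \<in> {1..d}"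
  shows "coact u d (\<lambda>v. if v = replicate n i then c else 0) w =
    (if length w = n then cscale c (\<Prod>j\<leftarrow>w. u i j) else 0)"
proof (induction w arbitrary: n)
  case (Cons j w)
  show ?case
  proof (cases n)
    case 0
    then show ?thesis by (simp add: coact_zero)
  next
    case (Suc k)
    have "coact u d (\<lambda>v. if i' # v = replicate n i then c else 0) w =
        (if i' = i then coact u d (\<lambda>v. if v = replicate k i then c else 0) w else 0)" for i'
      by (auto simp: Suc coact_zero)
    then show ?thesis
      using assms by (simp add: Suc Cons sum.delta' cscale_mult_right if_distrib cong: if_cong)
  qed
qed auto

lemma coact_free_dq:
  assumes "a \<in> {1..d}"
  shows "coact u d (free_dq a g h) w =
    (\<Sum>k<length w. coact u d g (take k w) * u a (w ! k) * coact u d h (drop (Suc k) w))"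
proof (induction w arbitrary: g)
  case (Cons j w)
  have "coact u d (free_dq a g h) (j # w) =
      (\<Sum>i\<in>{1..d}. if i = a then u i j * coact u d (\<lambda>v. g [] * h v) w else 0) +
      (\<Sum>i\<in>{1..d}. u i j * coact u d (free_dq a (\<lambda>v. g (i # v)) h) w)"
    unfolding sum.distrib[symmetric] coact.simps free_dq_Cons coact_add
    by (intro sum.cong refl) (simp add: coact_zero distrib_left)
  also have "(\<Sum>i\<in>{1..d}. if i = a then u i j * coact u d (\<lambda>v. g [] * h v) w else 0) =
      cscale (g []) (u a j * coact u d h w)"
    using assms by (simp add: coact_mult_left cscale_mult_right)
  also have "(\<Sum>i\<in>{1..d}. u i j * coact u d (free_dq a (\<lambda>v. g (i # v)) h) w) =
      (\<Sum>k<length w. coact u d g (j # take k w) * u a (w ! k) * coact u d h (drop (Suc k) w))"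
    unfolding Cons.IH coact.simps sum_distrib_left sum_distrib_right mult.assoc by (rule sum.swap)
  finally show ?case
    by (simp add: sum.lessThan_Suc_shift cscale_mult_left del: sum.lessThan_Suc)
qed simp

lemma orth_quantum_matrix_col:
  assumes "orth_quantum_matrix d u" "j \<in> {1..d}" "j' \<in> {1..d}"
  shows "(\<Sum>i\<in>{1..d}. u i j * u i j') = (if j = j' then 1 else 0)"
  using assms by (simp add: orth_quantum_matrix_def)

lemma orth_quantum_matrix_row:
  assumes "orth_quantum_matrix d u" "i \<in> {1..d}" "i' \<in> {1..d}"
  shows "(\<Sum>j\<in>{1..d}. u i j * u i' j) = (if i = i' then 1 else 0)"
  using assms by (simp add: orth_quantum_matrix_def)

lemma orth_quantum_matrix_sadj:
  assumes "orth_quantum_matrix d u" "i \<in> {1..d}" "j \<in> {1..d}"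
  shows "sadj (u i j) = u i j"
  using assms by (simp add: orth_quantum_matrix_def)

locale schwinger_dyson_functional =
  fixes u :: "nat \<Rightarrow> nat \<Rightarrow> 'b::star_algebra" and d :: nat
    and f :: "nat list \<Rightarrow> complex" and s c :: complex and N :: nat
  assumes orth: "orth_quantum_matrix d u"
    and unit: "f [] = 1"
    and recursion: "\<And>i v. i \<in> {1..d} \<Longrightarrow> set v \<subseteq> {1..d} \<Longrightarrow> length v \<le> N \<Longrightarrow>
      f (i # v) = s * free_dq i f f v + (if v = replicate N i then c else 0)"
begin

lemma coact_Cons:
  assumes "length w \<le> N"
  shows "coact u d f (j # w) =
    cscale s (\<Sum>k<length w. \<Sum>i\<in>{1..d}.
      u i j * (coact u d f (take k w) * u i (w ! k) * coact u d f (drop (Suc k) w))) +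
    (if length w = N then cscale c (\<Sum>i\<in>{1..d}. \<Prod>l\<leftarrow>j # w. u i l) else 0)"
proof -
  have "coact u d f (j # w) = (\<Sum>i\<in>{1..d}. u i j * (cscale s (coact u d (free_dq i f f) w) +
      (if length w = N then cscale c (\<Prod>l\<leftarrow>w. u i l) else 0)))"
    unfolding coact.simps
  proof (intro sum.cong refl arg_cong2[where f = "(*)"])
    fix i assume i_mem: "i \<in> {1..d}"
    have "coact u d (\<lambda>v. f (i # v)) w =
        coact u d (\<lambda>v. s * free_dq i f f v + (if v = replicate N i then c else 0)) w"
      using recursion[OF i_mem] assms by (intro coact_cong) simp
    then show "coact u d (\<lambda>v. f (i # v)) w = cscale s (coact u d (free_dq i f f) w) +
        (if length w = N then cscale c (\<Prod>l\<leftarrow>w. u i l) else 0)"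
      by (simp only: coact_add coact_mult_left coact_single_constant_word[OF i_mem])
  qed
  also have "\<dots> = cscale s (\<Sum>i\<in>{1..d}. u i j * coact u d (free_dq i f f) w) +
      (if length w = N then cscale c (\<Sum>i\<in>{1..d}. \<Prod>l\<leftarrow>j # w. u i l) else 0)"
    by (simp add: distrib_left sum.distrib cscale_mult_right cscale_sum_right)
  also have "(\<Sum>i\<in>{1..d}. u i j * coact u d (free_dq i f f) w) = (\<Sum>k<length w. \<Sum>i\<in>{1..d}.
      u i j * (coact u d f (take k w) * u i (w ! k) * coact u d f (drop (Suc k) w)))"
    by (subst sum.swap) (intro sum.cong refl, simp add: coact_free_dq sum_distrib_left)
  finally show ?thesis .
qed

lemma coact_Cons_if_invariant:
  assumes invariant: "\<And>v. set v \<subseteq> {1..d} \<Longrightarrow> length v \<le> length w \<Longrightarrow>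
      coact u d f v = cscale (f v) 1"
    and j_mem: "j \<in> {1..d}" and word: "set w \<subseteq> {1..d}" "length w \<le> N"
  shows "coact u d f (j # w) = cscale (s * free_dq j f f w) 1 +
    (if length w = N then cscale c (\<Sum>i\<in>{1..d}. \<Prod>l\<leftarrow>j # w. u i l) else 0)"
proof -
  have "(\<Sum>i\<in>{1..d}. u i j *
        (coact u d f (take k w) * u i (w ! k) * coact u d f (drop (Suc k) w))) =
      cscale (if w ! k = j then f (take k w) * f (drop (Suc k) w) else 0) 1"
    if "k < length w" for k
  proof -
    have "set (take k w) \<subseteq> {1..d}" "set (drop (Suc k) w) \<subseteq> {1..d}" "w ! k \<in> {1..d}"
      using word(1) that set_take_subset[of k w] set_drop_subset[of "Suc k" w] nth_mem[of k w]
      by blast+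
    then have "(\<Sum>i\<in>{1..d}. u i j *
        (coact u d f (take k w) * u i (w ! k) * coact u d f (drop (Suc k) w))) =
      cscale (f (take k w) * f (drop (Suc k) w)) (\<Sum>i\<in>{1..d}. u i j * u i (w ! k))"
      by (simp add: invariant cscale_mult_left cscale_mult_right cscale_cscale cscale_sum_right
          mult.commute)
    then show ?thesis
      using orth_quantum_matrix_col[OF orth j_mem \<open>w ! k \<in> {1..d}\<close>] by auto
  qed
  then show ?thesis
    using coact_Cons[OF word(2), of j]
    by (simp add: free_dq_def cscale_sum_left[symmetric] cscale_cscale)
qed

lemma coact_invariant:
  assumes "set w \<subseteq> {1..d}" "length w \<le> N"
  shows "coact u d f w = cscale (f w) 1"
  using assms
proof (induction "length w" arbitrary: w rule: less_induct)
  case less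
  show ?case
  proof (cases w)
    case Nil
    then show ?thesis by simp
  next
    case (Cons j v)
    then have "coact u d f (j # v) = cscale (s * free_dq j f f v) 1"
      using less by (subst coact_Cons_if_invariant) auto
    then show ?thesis using Cons less.prems recursion[of j v] by auto
  qed
qed

lemma coact_recursion:
  assumes "j \<in> {1..d}" "set w \<subseteq> {1..d}" "length w \<le> N"
  shows "coact u d f (j # w) = cscale (s * free_dq j f f w) 1 +
    (if length w = N then cscale c (\<Sum>i\<in>{1..d}. \<Prod>l\<leftarrow>j # w. u i l) else 0)"
  using assms by (intro coact_Cons_if_invariant coact_invariant) auto

end

section \<open>Freeness with amalgamation\<close>

context ncp_space
begin

lemma Ew_add_left: "Ew \<phi> X u d (x + x') b w = Ew \<phi> X u d x b w + Ew \<phi> X u d x' b w"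
proof (induction w arbitrary: x x' b)
  case (Cons l w)
  then show ?case by (cases l) (simp_all add: distrib_right sum.distrib)
qed (simp add: phi_add cscale_add_left)

lemma Ew_add_right: "Ew \<phi> X u d x (b + b') w = Ew \<phi> X u d x b w + Ew \<phi> X u d x b' w"
proof (induction w arbitrary: x b b')
  case (Cons l w)
  then show ?case by (cases l) (simp_all add: distrib_right sum.distrib)
qed (simp add: cscale_add_right)

lemma Ew_cscale: "Ew \<phi> X u d (cscale c x) b w = Ew \<phi> X u d x (cscale c b) w"
proof (induction w arbitrary: x b)
  case (Cons l w)
  then show ?case by (cases l) (simp_all add: cscale_mult_left)
qed (simp add: phi_scale cscale_cscale mult.commute)

lemma Ew_sum_right: "Ew \<phi> X u d x (\<Sum>i\<in>I. f i) w = (\<Sum>i\<in>I. Ew \<phi> X u d x (f i) w)"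
proof (induction I rule: infinite_finite_induct)
  have "Ew \<phi> X u d x 0 w = 0" using Ew_add_right[of X u d x 0 0 w] by simp
  then show "Ew \<phi> X u d x (\<Sum>i\<in>{}. f i) w = (\<Sum>i\<in>{}. Ew \<phi> X u d x (f i) w)"
    and "infinite I \<Longrightarrow> Ew \<phi> X u d x (\<Sum>i\<in>I. f i) w = (\<Sum>i\<in>I. Ew \<phi> X u d x (f i) w)" for I
    by simp_all
qed (simp add: Ew_add_right)

lemma Ew_map_LY:
  "Ew \<phi> X u d x b (map LY w) = b * coact u d (\<lambda>v. \<phi> (x * prod_list (map X v))) w"
proof (induction w arbitrary: x b)
  case Nil
  then show ?case by (simp add: cscale_mult_right)
next
  case (Cons j w)
  then show ?case by (simp add: sum_distrib_left mult.assoc)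
qed

lemma Ew_map_LY_one: "Ew \<phi> X u d 1 1 (map LY w) = coact u d (word_moment X) w"
  by (simp add: Ew_map_LY word_moment_def[abs_def])

end

text \<open>Replacing each \<open>X\<^sub>i\<close> by \<open>X\<^sub>i + \<mu>\<close> replaces \<open>Y\<^sub>j\<close> by \<open>Y\<^sub>j + 1 \<otimes> e\<^sub>j\<close> with
  \<open>e\<^sub>j = \<mu> \<Sum>\<^sub>i u\<^sub>i\<^sub>j\<close>; \<open>translate e w\<close> lists the words in the expansion of \<open>w\<close>.\<close>

fun translate :: "(nat \<Rightarrow> 'b) \<Rightarrow> 'b letter list \<Rightarrow> 'b letter list list" where
  "translate e [] = [[]]"
| "translate e (LB c # w) = map ((#) (LB c)) (translate e w)"
| "translate e (LY j # w) =
    map ((#) (LY j)) (translate e w) @ map ((#) (LB (e j))) (translate e w)"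

definition translate_words :: "(nat \<Rightarrow> 'b) \<Rightarrow> 'b letter list list \<Rightarrow> 'b letter list list" where
  "translate_words e ws = concat (map (translate e) ws)"

lemma translate_letters:
  assumes "v \<in> set (translate e w)" "l \<in> set v"
  shows "l \<in> range LB \<or> l \<in> set w"
  using assms by (induction e w arbitrary: v rule: translate.induct) fastforce+

lemma sum_list_translate_append:
  "(\<Sum>v\<leftarrow>translate e (w @ w'). F v) = (\<Sum>v\<leftarrow>translate e w. \<Sum>v'\<leftarrow>translate e w'. F (v @ v'))"
  by (induction e w arbitrary: F rule: translate.induct) (simp_all add: comp_def)

lemma sum_list_swap:
  fixes F :: "'i \<Rightarrow> 'j \<Rightarrow> 'c::comm_monoid_add"
  shows "(\<Sum>x\<leftarrow>xs. \<Sum>y\<leftarrow>ys. F x y) = (\<Sum>y\<leftarrow>ys. \<Sum>x\<leftarrow>xs. F x y)"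
  by (induction xs) (simp_all add: sum_list_addf)

lemma sum_sum_list_swap:
  fixes F :: "'i \<Rightarrow> 'j \<Rightarrow> 'c::comm_monoid_add"
  shows "(\<Sum>i\<in>A. \<Sum>y\<leftarrow>ys. F i y) = (\<Sum>y\<leftarrow>ys. \<Sum>i\<in>A. F i y)"
  by (induction ys) (simp_all add: sum.distrib)

lemma sum_list_concat_map: "(\<Sum>y\<leftarrow>concat (map f xs). F y) = (\<Sum>x\<leftarrow>xs. \<Sum>y\<leftarrow>f x. F y)"
  by (induction xs) simp_all

lemma sum_list_product_translate_words:
  fixes F :: "'b letter list \<Rightarrow> 'c::comm_monoid_add"
  shows "(\<Sum>v\<leftarrow>map concat (product_lists (map (translate_words e) as)). F v) =
    (\<Sum>v\<leftarrow>translate_words e (map concat (product_lists as)). F v)"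
proof (induction as arbitrary: F)
  case (Cons ws as)
  have product: "(\<Sum>v\<leftarrow>map concat (product_lists (xs # xss)). G v) =
      (\<Sum>w\<leftarrow>xs. \<Sum>v\<leftarrow>map concat (product_lists xss). G (w @ v))"
    for xs xss and G :: "'b letter list \<Rightarrow> 'c"
    by (induction xs) (simp_all add: comp_def)
  have "(\<Sum>v\<leftarrow>map concat (product_lists (map (translate_words e) (ws # as))). F v) =
      (\<Sum>w\<leftarrow>ws. \<Sum>v\<leftarrow>translate e w. \<Sum>z\<leftarrow>map concat (product_lists as). \<Sum>v'\<leftarrow>translate e z. F (v @ v'))"
    unfolding list.map product Cons.IH
    by (simp add: translate_words_def sum_list_concat_map comp_def)
  also have "\<dots> = (\<Sum>w\<leftarrow>ws. \<Sum>z\<leftarrow>map concat (product_lists as). \<Sum>v\<leftarrow>translate e (w @ z). F v)"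
    unfolding sum_list_translate_append by (subst sum_list_swap) (rule refl)
  also have "\<dots> = (\<Sum>v\<leftarrow>translate_words e (map concat (product_lists (ws # as))). F v)"
    unfolding translate_words_def sum_list_concat_map product ..
  finally show ?case .
qed (simp add: translate_words_def)

context ncp_space
begin

lemma Ew_shift:
  "Ew \<phi> (\<lambda>i. X i + cscale \<mu> 1) u d x b w =
    (\<Sum>v\<leftarrow>translate (\<lambda>j. cscale \<mu> (\<Sum>i\<in>{1..d}. u i j)) w. Ew \<phi> X u d x b v)"
proof (induction w arbitrary: x b)
  case (Cons l w)
  let ?E' = "Ew \<phi> (\<lambda>i. X i + cscale \<mu> 1) u d"
  show ?case
  proof (cases l)
    case (LB c)
    then show ?thesis by (simp add: Cons comp_def)
  next
    case (LY j)
    have "?E' x b (LY j # w) =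
        (\<Sum>i\<in>{1..d}. ?E' (x * X i) (b * u i j) w + ?E' x (cscale \<mu> (b * u i j)) w)"
      by (simp add: distrib_left cscale_mult_right Ew_add_left Ew_cscale)
    also have "\<dots> = (\<Sum>i\<in>{1..d}. ?E' (x * X i) (b * u i j) w) +
        ?E' x (b * cscale \<mu> (\<Sum>i\<in>{1..d}. u i j)) w"
      by (simp add: sum.distrib cscale_mult_right cscale_sum_right sum_distrib_left Ew_sum_right)
    finally show ?thesis
      by (simp add: LY Cons comp_def sum_sum_list_swap)
  qed
qed simp

lemma Esum_shift:
  "Esum \<phi> (\<lambda>i. X i + cscale \<mu> 1) u d ws =
    Esum \<phi> X u d (translate_words (\<lambda>j. cscale \<mu> (\<Sum>i\<in>{1..d}. u i j)) ws)"
  by (simp add: Esum_def Ew_shift translate_words_def sum_list_concat_map)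

lemma amalg_free_Y_shift:
  assumes "amalg_free_Y \<phi> X u d"
  shows "amalg_free_Y \<phi> (\<lambda>i. X i + cscale \<mu> 1) u d"
  unfolding amalg_free_Y_def Esum_shift
proof (intro allI impI, elim conjE)
  fix ks and as :: "'b letter list list list"
  let ?T = "translate_words (\<lambda>j. cscale \<mu> (\<Sum>i\<in>{1..d}. u i j))"
  assume "length as = length ks" "ks \<noteq> []"
    and factors: "\<forall>r<length ks. ks ! r \<in> {1..d} \<and>
      (\<forall>w\<in>set (as ! r). \<forall>l\<in>set w. l \<in> range LB \<or> l = LY (ks ! r)) \<and>
      Esum \<phi> X u d (?T (as ! r)) = 0"
    and "\<forall>r. Suc r < length ks \<longrightarrow> ks ! r \<noteq> ks ! Suc r"
  moreover have "l \<in> range LB \<or> l = LY (ks ! r)"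
    if "r < length ks" "w \<in> set (?T (as ! r))" "l \<in> set w" for r w l
    using factors that translate_letters by (fastforce simp: translate_words_def)
  ultimately have "Esum \<phi> X u d (map concat (product_lists (map ?T as))) = 0"
    using assms[unfolded amalg_free_Y_def, rule_format, of "map ?T as" ks] by simp
  then show "Esum \<phi> X u d (?T (map concat (product_lists as))) = 0"
    by (simp only: Esum_def sum_list_product_translate_words)
qed

end

locale amalgamated_family = centred_iid_family \<phi> d X m
  for \<phi> :: "'a::star_algebra \<Rightarrow> complex" and d X m +
  fixes u :: "nat \<Rightarrow> nat \<Rightarrow> 'b::star_algebra"
  assumes orth: "orth_quantum_matrix d u" and amalg: "amalg_free_Y \<phi> X u d"
begin

abbreviation Y_moment :: "nat list \<Rightarrow> 'b" where
  "Y_moment \<equiv> coact u d moment"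

lemma Esum_product_eq_zero:
  assumes "list_all2 (\<lambda>k ws. k \<in> {1..d} \<and> (\<forall>w\<in>set ws. \<forall>l\<in>set w. l \<in> range LB \<or> l = LY k) \<and>
      Esum \<phi> X u d ws = 0) ks as"
    and "distinct_adj ks" "ks \<noteq> []"
  shows "Esum \<phi> X u d (map concat (product_lists as)) = 0"
  using amalg assms unfolding amalg_free_Y_def distinct_adj_conv_nth list_all2_conv_all_nth
  by metis

lemma Esum_single_letter: "j \<in> {1..d} \<Longrightarrow> Esum \<phi> X u d [[LY j]] = 0"
  using moments[of _ 1] centred by (simp add: Esum_def)

lemma Esum_centred_power:
  "Esum \<phi> X u d [replicate n (LY j), [LB (- Y_moment (replicate n j))]] = 0"
  using Ew_map_LY_one[of X u d "replicate n j"] by (simp add: Esum_def phi_one cscale_one)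

lemma Y_moment_two_blocks:
  assumes "j \<in> {1..d}" "j' \<in> {1..d}" "j \<noteq> j'"
  shows "Y_moment (j # replicate n j') = 0"
proof -
  let ?e = "Y_moment (replicate n j')"
  have "Esum \<phi> X u d (map concat (product_lists
      [[[LY j]], [replicate n (LY j'), [LB (- ?e)]]])) = 0"
    by (rule Esum_product_eq_zero[where ks = "[j, j']"])
      (use assms in \<open>auto simp: Esum_single_letter Esum_centred_power\<close>)
  then have "Ew \<phi> X u d 1 1 (map LY (j # replicate n j')) +
      Ew \<phi> X u d 1 1 [LY j, LB (- ?e)] = 0"
    by (simp add: Esum_def)
  moreover have "Ew \<phi> X u d 1 1 [LY j, LB (- ?e)] = 0"
    using moments[of _ 1] centred by simp
  ultimately show ?thesis by (simp only: Ew_map_LY_one add_0_right)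
qed

lemma Y_moment_three_blocks:
  assumes "j \<in> {1..d}" "j' \<in> {1..d}" "j'' \<in> {1..d}" "j \<noteq> j'" "j' \<noteq> j''"
    and "Y_moment (replicate n j') = cscale r 1"
  shows "Y_moment (j # replicate n j' @ [j'']) = cscale r (Y_moment [j, j''])"
proof -
  have "Esum \<phi> X u d (map concat (product_lists
      [[[LY j]], [replicate n (LY j'), [LB (cscale (- r) 1)]], [[LY j'']]])) = 0"
    by (rule Esum_product_eq_zero[where ks = "[j, j', j'']"])
      (use assms Esum_centred_power[of n j'] in
        \<open>auto simp: Esum_single_letter cscale_minus_left\<close>)
  then have "Ew \<phi> X u d 1 1 (map LY (j # replicate n j' @ [j''])) +
      Ew \<phi> X u d 1 1 [LY j, LB (cscale (- r) 1), LY j''] = 0"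
    by (simp add: Esum_def)
  moreover have "Ew \<phi> X u d 1 1 [LY j, LB (cscale (- r) 1), LY j''] =
      - cscale r (Ew \<phi> X u d 1 1 (map LY [j, j'']))"
    by (simp add: cscale_mult_left cscale_mult_right cscale_cscale cscale_sum_right mult.commute)
      (simp add: cscale_minus_left sum_negf)
  ultimately show ?thesis by (simp only: Ew_map_LY_one add_eq_0_iff neg_equal_iff_equal)
qed

lemma Y_moment_sandwich:
  assumes letters: "j \<in> {1..d}" "j' \<in> {1..d}" "j'' \<in> {1..d}" "j \<noteq> j'"
    and pair: "Y_moment [j, j''] = cscale (if j'' = j then s else 0) 1"
    and scalar: "Y_moment (replicate n j') = cscale r 1"
  shows "Y_moment (j # replicate n j' @ [j'']) = cscale (if j'' = j then s * r else 0) 1"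
proof (cases "j'' = j'")
  case True
  then have "replicate n j' @ [j''] = replicate (Suc n) j'"
    by (simp add: replicate_append_same)
  then show ?thesis
    using Y_moment_two_blocks[OF letters(1,2,4), of "Suc n"] True letters(4)
    by (simp del: coact.simps replicate_Suc)
next
  case False
  then have "Y_moment (j # replicate n j' @ [j'']) = cscale r (Y_moment [j, j''])"
    using letters scalar by (intro Y_moment_three_blocks) auto
  then show ?thesis
    unfolding pair
    by (cases "j'' = j") (simp_all add: cscale_cscale mult.commute del: coact.simps)
qed

lemma sum_mixed_entries_eq_zero:
  assumes below: "\<And>k. k < N \<Longrightarrow> semicircle_defect m k = 0"
    and defect: "semicircle_defect m N \<noteq> 0" and N_ge_2: "N \<ge> 2"
    and letters: "j \<in> {1..d}" "j' \<in> {1..d}" "j'' \<in> {1..d}" "j \<noteq> j'"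
  shows "(\<Sum>i\<in>{1..d}. u i j * u i j' ^ (N - 1) * u i j'') = 0"
proof -
  let ?power = "replicate (N - 1) j'"
  let ?w = "?power @ [j'']"
  interpret schwinger_dyson_functional u d moment "m 2" "semicircle_defect m N" N
    using orth schwinger_dyson_defect_eq[OF below]
    by unfold_locales (auto simp: word_moment_def phi_one schwinger_dyson_defect_def algebra_simps)
  have word_length: "length ?w = N" and word_letters: "set ?w \<subseteq> {1..d}"
    using N_ge_2 letters by auto
  have free_dq_word: "free_dq j moment moment ?w = (if j'' = j then moment ?power else 0)"
    using letters(4) by (simp add: free_dq_append free_dq_eq_zero unit)
  have "Y_moment [j, j''] = cscale (if j'' = j then m 2 else 0) 1"
    using coact_recursion[of j "[j'']"] letters N_ge_2 by (simp add: unit)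
  moreover have "Y_moment ?power = cscale (moment ?power) 1"
    by (rule coact_invariant) (use letters N_ge_2 in auto)
  ultimately have "Y_moment (j # ?w) = cscale (m 2 * free_dq j moment moment ?w) 1"
    using Y_moment_sandwich[OF letters] unfolding free_dq_word by simp
  moreover have "Y_moment (j # ?w) = cscale (m 2 * free_dq j moment moment ?w) 1 +
      cscale (semicircle_defect m N) (\<Sum>i\<in>{1..d}. \<Prod>l\<leftarrow>j # ?w. u i l)"
    using coact_recursion[OF letters(1) word_letters] word_length by simp
  ultimately have "(\<Sum>i\<in>{1..d}. \<Prod>l\<leftarrow>j # ?w. u i l) = 0"
    using defect by (simp add: cscale_eq_0_iff)
  then show ?thesis by (simp add: mult.assoc)
qed

lemma entry_mult_power_eq_zero:
  assumes below: "\<And>k. k < N \<Longrightarrow> semicircle_defect m k = 0"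
    and defect: "semicircle_defect m N \<noteq> 0" and N_ge_2: "N \<ge> 2"
    and k_mem: "k \<in> {1..d}" and letters: "j \<in> {1..d}" "j' \<in> {1..d}" "j \<noteq> j'"
  shows "u k j * u k j' ^ (N - 1) = 0"
proof -
  let ?A = "\<lambda>i. u i j * u i j' ^ (N - 1)"
  have "0 = (\<Sum>l\<in>{1..d}. (\<Sum>i\<in>{1..d}. ?A i * u i l) * u k l)"
    using sum_mixed_entries_eq_zero[OF below defect N_ge_2 letters(1,2) _ letters(3)] by simp
  also have "\<dots> = (\<Sum>i\<in>{1..d}. ?A i * (\<Sum>l\<in>{1..d}. u i l * u k l))"
    unfolding sum_distrib_right sum_distrib_left mult.assoc by (rule sum.swap)
  also have "\<dots> = (\<Sum>i\<in>{1..d}. if i = k then ?A k else 0)"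
    by (intro sum.cong refl) (simp add: orth_quantum_matrix_row[OF orth _ k_mem] del: One_nat_def)
  also have "\<dots> = ?A k" using k_mem by simp
  finally show ?thesis ..
qed

end

section \<open>Algebras with a faithful representation\<close>

lemma sadj_zero [simp]: "sadj 0 = (0::'a::star_algebra)"
  using sadj_add[of 0 "0::'a"] by simp

lemma sadj_one [simp]: "sadj 1 = (1::'a::star_algebra)"
  using sadj_mult[of "sadj 1" "1::'a"] by (simp add: sadj_sadj)

lemma sadj_power: "sadj (x ^ n) = sadj x ^ n"
  by (induction n) (simp_all add: sadj_mult power_commutes)

lemma sadj_mult_self_eq_zeroD:
  fixes \<pi> :: "'b::star_algebra \<Rightarrow> 'h::chilbert \<Rightarrow> 'h"
    and y :: 'b
  assumes rep: "faithful_star_rep \<pi>" and "sadj y * y = 0"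
  shows "y = 0"
proof -
  have add: "\<And>b c x. \<pi> (b + c) x = \<pi> b x + \<pi> c x"
    and mult: "\<And>b c x. \<pi> (b * c) x = \<pi> b (\<pi> c x)"
    and adj: "\<And>b x y. hinner (\<pi> b x) y = hinner x (\<pi> (sadj b) y)"
    and inj: "inj \<pi>"
    using rep unfolding faithful_star_rep_def by blast+
  have zero: "\<pi> 0 x = 0" for x using add[of 0 0 x] by simp
  have "\<pi> y x = \<pi> 0 x" for x
  proof -
    have "hinner (\<pi> y x) (\<pi> y x) = hinner x (\<pi> (sadj y * y) x)"
      by (simp add: adj mult)
    also have "\<dots> = 0"
      using hinner_add_right[of x 0 0] by (simp add: assms(2) zero)
    finally show ?thesis using hinner_definite zero by metis
  qed
  then show ?thesis using inj by (metis ext injD)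
qed

lemma selfadjoint_power_mult_eq_zeroD:
  fixes t b :: "'b::star_algebra" and \<pi> :: "'b \<Rightarrow> 'h::chilbert \<Rightarrow> 'h"
  assumes rep: "faithful_star_rep \<pi>" and selfadjoint: "sadj t = t" and "t ^ Suc n * b = 0"
  shows "t * b = 0"
  using assms(3)
proof (induction n)
  case (Suc n)
  let ?y = "t ^ Suc n * b"
  have "sadj ?y * ?y = sadj b * (t ^ Suc n * t ^ Suc n) * b"
    by (simp only: sadj_mult sadj_power selfadjoint mult.assoc)
  also have "t ^ Suc n * t ^ Suc n = t ^ n * t ^ Suc (Suc n)"
    by (simp only: power_add[symmetric] add_Suc add_Suc_right)
  also have "sadj b * (t ^ n * t ^ Suc (Suc n)) * b = sadj b * t ^ n * (t ^ Suc (Suc n) * b)"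
    by (simp only: mult.assoc)
  also have "\<dots> = 0" by (simp only: Suc.prems mult_zero_right)
  finally have "?y = 0" by (rule sadj_mult_self_eq_zeroD[OF rep])
  then show ?case by (rule Suc.IH)
qed simp

lemma orth_quantum_matrix_square_eq_fourth:
  assumes orth: "orth_quantum_matrix d u" and i_mem: "i \<in> {1..d}" and j_mem: "j \<in> {1..d}"
    and row: "\<And>l. l \<in> {1..d} \<Longrightarrow> l \<noteq> j \<Longrightarrow> u i j * u i l = 0"
  shows "u i j ^ 2 = u i j ^ 4"
proof -
  have "u i j ^ 2 = u i j ^ 2 * (\<Sum>l\<in>{1..d}. u i l * u i l)"
    by (simp add: orth_quantum_matrix_row[OF orth i_mem i_mem] del: One_nat_def)
  also have "\<dots> = (\<Sum>l\<in>{1..d}. u i j * (u i j * u i l) * u i l)"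
    by (simp add: sum_distrib_left power2_eq_square mult.assoc)
  also have "\<dots> = (\<Sum>l\<in>{1..d}. if l = j then u i j ^ 4 else 0)"
  proof (intro sum.cong refl)
    fix l assume "l \<in> {1..d}"
    then show "u i j * (u i j * u i l) * u i l = (if l = j then u i j ^ 4 else 0)"
      using row[of l] by (cases "l = j") (simp_all add: power4_eq_xxxx mult.assoc)
  qed
  also have "\<dots> = u i j ^ 4" using j_mem by simp
  finally show ?thesis .
qed

lemma (in amalgamated_family) entry_square_eq_fourth:
  fixes \<pi> :: "'b \<Rightarrow> 'h::chilbert \<Rightarrow> 'h"
  assumes rep: "faithful_star_rep \<pi>" and "semicircle_defect m k \<noteq> 0"
    and i_mem: "i \<in> {1..d}" and j_mem: "j \<in> {1..d}"
  shows "u i j ^ 2 = u i j ^ 4"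
proof (rule orth_quantum_matrix_square_eq_fourth[OF orth i_mem j_mem])
  define N where "N = (LEAST k. semicircle_defect m k \<noteq> 0)"
  have defect: "semicircle_defect m N \<noteq> 0" unfolding N_def by (rule LeastI) (rule assms(2))
  have below: "semicircle_defect m k = 0" if "k < N" for k
    using not_less_Least that unfolding N_def by blast
  have "semicircle_defect m 0 = 0" "semicircle_defect m 1 = 0"
    using centred moments[OF i_mem, of 0]
    by (simp_all add: semicircle_defect_def phi_one numeral_2_eq_2)
  then have "N \<noteq> 0" "N \<noteq> 1" using defect by metis+
  then have N_ge_2: "N \<ge> 2" and Suc_N: "Suc (N - 2) = N - 1" by simp_all
  fix l assume l_mem: "l \<in> {1..d}" "l \<noteq> j"
  have "sadj (u i l * u i j ^ (N - 1)) = 0"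
    by (simp only: sadj_zero
        entry_mult_power_eq_zero[OF below defect N_ge_2 i_mem l_mem(1) j_mem l_mem(2)])
  then have "u i j ^ Suc (N - 2) * u i l = 0"
    by (simp only: sadj_mult sadj_power orth_quantum_matrix_sadj[OF orth i_mem] l_mem(1) j_mem Suc_N)
  then show "u i j * u i l = 0"
    by (rule selfadjoint_power_mult_eq_zeroD[OF rep orth_quantum_matrix_sadj[OF orth i_mem j_mem]])
qed

lemma amalgamated_family_centred:
  assumes "ncps \<phi>" and iid: "freely_independent \<phi> d X"
      "\<And>i j n. i \<in> {1..d} \<Longrightarrow> j \<in> {1..d} \<Longrightarrow> \<phi> (X i ^ n) = \<phi> (X j ^ n)"
    and "orth_quantum_matrix d u" "amalg_free_Y \<phi> X u d" and "d \<ge> 1"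
    and centring: "\<mu> = \<phi> (X 1)" "\<And>i. Z i = X i - cscale \<mu> 1" "\<And>k. m k = \<phi> (Z 1 ^ k)"
  shows "amalgamated_family \<phi> d Z m u"
proof -
  interpret ncp_space \<phi> by unfold_locales (rule assms(1))
  show ?thesis
  proof
    show "freely_independent \<phi> d Z"
      using iid(1)
      by (rule freely_independent_salg) (simp add: centring salg_diff_scalar salg_gen)
    show "\<phi> (Z i ^ k) = m k" if "i \<in> {1..d}" for i k
      unfolding centring(2,3) by (intro shifted_moments_cong iid(2)) (use that assms(6) in auto)
    show "m 1 = 0" by (simp add: centring phi_diff phi_scale phi_one)
    have "Z = (\<lambda>i. X i + cscale (- \<mu>) 1)"
      by (simp add: centring(2) fun_eq_iff cscale_minus_left)
    then show "amalg_free_Y \<phi> Z u d" using amalg_free_Y_shift assms(5) by simp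
  qed (rule assms(4))
qed

theorem mainTheorem1:
  fixes d :: nat
    and u :: "nat \<Rightarrow> nat \<Rightarrow> 'b::star_algebra"
    and \<pi> :: "'b \<Rightarrow> 'h::chilbert \<Rightarrow> 'h"
    and \<phi> :: "'a::star_algebra \<Rightarrow> complex"
    and X :: "nat \<Rightarrow> 'a"
  assumes "d \<ge> 2"
    and "orth_quantum_matrix d u"
    and "faithful_star_rep \<pi>"
    and "ncps \<phi>"
    and "\<forall>i\<in>{1..d}. sadj (X i) = X i"
    and "freely_independent \<phi> d X"
    and "\<forall>i\<in>{1..d}. \<forall>j\<in>{1..d}. \<forall>n. \<phi> (X i ^ n) = \<phi> (X j ^ n)"
    and "amalg_free_Y \<phi> X u d"
  shows "(\<forall>i\<in>{1..d}. \<forall>j\<in>{1..d}. u i j ^ 2 = u i j ^ 4) \<or>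
         (\<forall>\<kappa>. free_cumulants \<phi> \<kappa> \<longrightarrow>
            (\<forall>i\<in>{1..d}. \<forall>n\<ge>3. \<kappa> (replicate n (X i)) = 0))"
proof -
  define \<mu> where "\<mu> = \<phi> (X 1)"
  define Z where "Z i = X i - cscale \<mu> 1" for i
  define m where "m k = \<phi> (Z 1 ^ k)" for k
  interpret amalgamated_family \<phi> d Z m u
    by (rule amalgamated_family_centred[OF assms(4,6) _ assms(2,8) _ \<mu>_def Z_def m_def])
      (use assms(1,7) in \<open>blast, simp\<close>)
  show ?thesis
  proof (cases "\<forall>k. semicircle_defect m k = 0")
    case True
    then show ?thesis
      using free_cumulants_eq_zero_if_no_defect[where \<mu> = \<mu>] moments by (simp add: Z_def)
  next
    case False
    then show ?thesis using entry_square_eq_fourth[OF assms(3)] by blast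
  qed
qed

end
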